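(* Consider the support boundary model with parameter $n$ and unknown boundary function $f$, and let $x_0\in[0,1]$. Let $0<\beta<1$, $C>0$ and $$R>\kappa:=2\inf\{\|K\|_{\mathscr C^\beta(\mathbb R)}:\ K\in L^2(\mathbb R),\ K(0)=1,\ K\ge0\}.$$ For any estimator $\widehat f$ with $$\sup_{f\in\mathscr C^\beta(R)}\mathrm{MSE}_f\big(\widehat f(x_0)\big)<\Big(\frac Cn\Big)^{2\beta/(\beta+1)},$$ there exist positive constants $c:=c(\beta,C,R)$ and $c':=c'(\beta,C,R)$ such that $$\sup_{f\in\mathscr C^\beta(R)}\mathrm{Bias}_f\big(\widehat f(x_0)\big)^2\ \geq\ c\,n^{-\frac{2\beta}{\beta+1}},$$ and $$\mathrm{Var}_f\big(\widehat f(x_0)\big)\ \geq\ c'\,n^{-\frac{2\beta}{\beta+1}}\qquad\text{for all } f\in\mathscr C^\beta\big((R-\kappa)/2\big).$$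
   Context: Support boundary model: one observes a Poisson point process $N=\sum_i\delta_{(X_i,Y_i)}$ in the plane $(x,y)\in[0,1]\times\mathbb R$ with intensity $\lambda_f(x,y)=n\mathbf 1(f(x)\le y)$, where $f:[0,1]\to\mathbb R$ is the unknown boundary function and $n$ plays the role of the sample size; $E_f,\mathrm{Var}_f$ denote expectation and variance under the corresponding distribution. $\widehat f(x_0)$ is a real-valued estimator of $f(x_0)$ based on $N$; $\mathrm{Bias}_f(\widehat f(x_0))=E_f[\widehat f(x_0)]-f(x_0)$ and $\mathrm{MSE}_f(\widehat f(x_0))=E_f[(\widehat f(x_0)-f(x_0))^2]$. For $0<\beta<1$ and $D\subseteq\mathbb R$, $\|f\|_{\mathscr C^\beta(D)}=\|f\|_{L^\infty(D)}+\sup_{x,y\in D,x\ne y}|f(x)-f(y)|/|x-y|^\beta$, with $\|\cdot\|_{L^\infty(D)}$ the supremum norm on $D$. For $r>0$, $\mathscr C^\beta(r):=\{f:[0,1]\to\mathbb R:\|f\|_{\mathscr C^\beta([0,1])}\le r\}$. The infimum defining $\kappa$ is over functions $K:\mathbb R\to\mathbb R$.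
   Formalization: The formal theorem takes n ≥ 1 and claims the variance bound only for n ≥ n₀(β, C, R): for small n with R² < (C/n)^{2β/(β+1)}, the zero estimator meets the MSE condition but has variance 0. *)

theory Defs
  imports "HOL-Probability.Probability"
begin

text \<open>
  A point configuration on \<open>M\<close> is a measure of the form \<open>\<Sum>i\<in>I. \<delta>(p i)\<close> with a
  finite or countably infinite index set \<open>I\<close>; thus \<open>emeasure \<mu> A\<close> is the number of \<open>i \<in> I\<close> with
  \<open>p i \<in> A\<close>.  Multiple points are allowed.  Configurations carry the
  \<open>\<sigma>\<close>-algebra generated by the counts \<open>\<mu> \<mapsto> \<mu>(A)\<close>.
\<close>

definition point_configurations :: "'a measure \<Rightarrow> 'a measure set" where
  "point_configurations M =
     {\<mu>. sets \<mu> = sets M \<and>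
         (\<exists>(I::nat set) p. p ` I \<subseteq> space M \<and>
            (\<forall>A\<in>sets M. emeasure \<mu> A = emeasure (count_space I) {i\<in>I. p i \<in> A}))}"

definition configuration_space :: "'a measure \<Rightarrow> 'a measure measure" where
  "configuration_space M =
     sigma (point_configurations M)
       {{\<mu> \<in> point_configurations M. emeasure \<mu> A \<in> B} | A B. A \<in> sets M \<and> B \<in> sets borel}"

text \<open>
  \<open>P\<close> is the distribution of a Poisson point process with intensity measure \<open>\<Lambda>\<close>.
  The count of a set of infinite intensity is almost surely infinite; this
  follows from the two conditions below when \<open>\<Lambda>\<close> is \<open>\<sigma>\<close>-finite.
\<close>

definition poisson_process_law :: "'a measure \<Rightarrow> 'a measure measure \<Rightarrow> bool" where
  "poisson_process_law \<Lambda> P \<longleftrightarrow>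
     prob_space P \<and>
     sets P = sets (configuration_space \<Lambda>) \<and>
     (\<forall>A\<in>sets \<Lambda>. emeasure \<Lambda> A < \<infinity> \<longrightarrow>
        (\<forall>k::nat. measure P {N \<in> space P. emeasure N A = of_nat k} =
           exp (- measure \<Lambda> A) * measure \<Lambda> A ^ k / fact k)) \<and>
     (\<forall>A::nat \<Rightarrow> 'a set. range A \<subseteq> sets \<Lambda> \<longrightarrow> disjoint_family A \<longrightarrow>
        prob_space.indep_vars P (\<lambda>_. borel) (\<lambda>i N. emeasure N (A i)) UNIV)"

definition strip :: "(real \<times> real) measure" where
  "strip = restrict_space lborel ({0..1} \<times> UNIV)"

definition boundary_intensity :: "real \<Rightarrow> (real \<Rightarrow> real) \<Rightarrow> (real \<times> real) measure" where
  "boundary_intensity n f =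
     density strip (\<lambda>(x, y). ennreal (n * (if f x \<le> y then 1 else 0)))"

text \<open>
  Distribution \<open>P\<close> of the observation and estimator \<open>T\<close> of the real number \<open>\<theta>\<close>. The mean
  squared error is a nonnegative extended integral, because the Bochner integral of a
  non-integrable function is \<open>0\<close>.
\<close>

definition MSE :: "'b measure \<Rightarrow> ('b \<Rightarrow> real) \<Rightarrow> real \<Rightarrow> ennreal" where
  "MSE P T \<theta> = (\<integral>\<^sup>+N. ennreal ((T N - \<theta>)\<^sup>2) \<partial>P)"

definition bias :: "'b measure \<Rightarrow> ('b \<Rightarrow> real) \<Rightarrow> real \<Rightarrow> real" where
  "bias P T \<theta> = prob_space.expectation P T - \<theta>"

definition hoelder_norm :: "real \<Rightarrow> real set \<Rightarrow> (real \<Rightarrow> real) \<Rightarrow> ennreal" where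
  "hoelder_norm \<beta> D f =
     (SUP x\<in>D. ennreal \<bar>f x\<bar>) +
     (SUP (x, y)\<in>{(x, y). x \<in> D \<and> y \<in> D \<and> x \<noteq> y}.
        ennreal (\<bar>f x - f y\<bar> / \<bar>x - y\<bar> powr \<beta>))"

text \<open>
  Functions on \<open>[0,1]\<close> are represented by total functions whose values outside
  \<open>[0,1]\<close> are irrelevant.
\<close>

definition hoelder_ball :: "real \<Rightarrow> real \<Rightarrow> (real \<Rightarrow> real) set" where
  "hoelder_ball \<beta> r = {f. hoelder_norm \<beta> {0..1} f \<le> ennreal r}"

definition kernels :: "(real \<Rightarrow> real) set" where
  "kernels = {K. K \<in> borel_measurable lebesgue \<and> integrable lebesgue (\<lambda>x. (K x)\<^sup>2) \<and>
                 K 0 = 1 \<and> (\<forall>x. 0 \<le> K x)}"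

definition kappa :: "real \<Rightarrow> real" where
  "kappa \<beta> = 2 * enn2real (INF K\<in>kernels. hoelder_norm \<beta> UNIV K)"

text \<open>The infimum is finite, so that the conversion to a real number loses nothing.\<close>

lemma kernel_infimum_finite:
  assumes "0 < \<beta>" "\<beta> < 1"
  shows "(INF K\<in>kernels. hoelder_norm \<beta> UNIV K) < \<infinity>"
proof -
  define K :: "real \<Rightarrow> real" where "K = (\<lambda>x. max 0 (1 - \<bar>x\<bar>))"
  have cont: "continuous_on A K" for A
    unfolding K_def by (intro continuous_intros)
  have meas: "K \<in> borel_measurable borel"
    using cont by (rule borel_measurable_continuous_onI)
  have eq: "(\<lambda>x. (K x)\<^sup>2) = (\<lambda>x. indicator {-1..1} x *\<^sub>R (K x)\<^sup>2)"
    by (auto simp: K_def indicator_def fun_eq_iff)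
  have "integrable lborel (\<lambda>x. (K x)\<^sup>2)"
    by (subst eq, rule borel_integrable_compact)
       (auto intro!: continuous_intros cont)
  then have int: "integrable lebesgue (\<lambda>x. (K x)\<^sup>2)"
    using meas by (subst integrable_completion) auto
  have ker: "K \<in> kernels"
    unfolding kernels_def using int meas
    by (auto simp: K_def intro!: measurable_completion)
  have 1: "(SUP x. ennreal \<bar>K x\<bar>) \<le> 1"
    by (rule SUP_least) (auto simp: K_def)
  have q: "\<bar>K x - K y\<bar> / \<bar>x - y\<bar> powr \<beta> \<le> 1" if "x \<noteq> y" for x y
  proof -
    have "\<bar>K x - K y\<bar> \<le> \<bar>x - y\<bar>" "\<bar>K x - K y\<bar> \<le> 1"
      unfolding K_def by auto
    moreover have "\<bar>x - y\<bar> \<le> \<bar>x - y\<bar> powr \<beta>" if "\<bar>x - y\<bar> \<le> 1"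
      using powr_mono'[of \<beta> 1 "\<bar>x - y\<bar>"] that assms by simp
    moreover have "1 \<le> \<bar>x - y\<bar> powr \<beta>" if "\<bar>x - y\<bar> \<ge> 1"
      using that assms by (intro ge_one_powr_ge_zero) auto
    ultimately have "\<bar>K x - K y\<bar> \<le> \<bar>x - y\<bar> powr \<beta>"
      by linarith
    then show ?thesis using that by (simp add: divide_le_eq)
  qed
  have 2: "(SUP (x, y)\<in>{(x, y). x \<in> UNIV \<and> y \<in> UNIV \<and> x \<noteq> y}.
        ennreal (\<bar>K x - K y\<bar> / \<bar>x - y\<bar> powr \<beta>)) \<le> 1"
    by (rule SUP_least) (use q in auto)
  have "(INF K\<in>kernels. hoelder_norm \<beta> UNIV K) \<le> hoelder_norm \<beta> UNIV K"
    using ker by (rule INF_lower)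
  also have "\<dots> \<le> 1 + 1"
    unfolding hoelder_norm_def by (rule add_mono[OF 1 2])
  also have "\<dots> < \<infinity>" by simp
  finally show ?thesis .
qed

end

theory Submission
  imports Defs
begin

text \<open>
  If \<open>f \<le> g\<close>, the process with boundary \<open>g\<close> is the process with boundary \<open>f\<close> conditioned on
  having no point in the gap between the two graphs. If the gap has intensity at most \<open>v\<close>, the
  likelihood ratio therefore has variance at most \<open>exp v - 1\<close>, and Cauchy-Schwarz gives
  \<open>(E\<^sub>g T - E\<^sub>f T)\<^sup>2 \<le> (exp v - 1) * Var\<^sub>f T\<close>.

  Take \<open>g = f + max 0 (h powr \<beta> - \<bar>x - x\<^sub>0\<bar> powr \<beta>)\<close> with \<open>h = (a / n) powr (1 / (\<beta> + 1))\<close>,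
  so that \<open>v = 2 * a\<close>, and let \<open>q = \<beta> / (\<beta> + 1)\<close>. The perturbation has Hoelder norm at most
  \<open>h powr \<beta> + 1\<close>, which suffices since \<open>kappa \<beta> \<ge> 2\<close>. For the variance, \<open>a\<close> is chosen so large
  that the values at \<open>x\<^sub>0\<close> differ by three times the bound on the root mean squared error; then the
  expectations must differ. For the bias, \<open>f = 0\<close> and \<open>a\<close> is small: the values differ by order
  \<open>a powr q\<close>, the expectations only by order \<open>a powr (1/2)\<close>, and \<open>q < 1/2\<close>.
\<close>

subsection \<open>Uniqueness of the law of a Poisson process\<close>

lemma space_configuration_space [simp]:
  "space (configuration_space M) = point_configurations M"
  unfolding configuration_space_def by (rule space_measure_of) auto

lemma configuration_space_cong:
  assumes "sets M = sets M'"
  shows "configuration_space M = configuration_space M'"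
proof -
  have "point_configurations M = point_configurations M'"
    unfolding point_configurations_def using assms sets_eq_imp_space_eq[OF assms] by simp
  then show ?thesis
    unfolding configuration_space_def using assms by simp
qed

lemma measurable_count:
  assumes "A \<in> sets M"
  shows "(\<lambda>N. emeasure N A) \<in> borel_measurable (configuration_space M)"
proof (rule measurableI)
  fix B :: "ennreal set" assume B: "B \<in> sets borel"
  have "(\<lambda>N. emeasure N A) -` B \<inter> space (configuration_space M) =
      {\<mu> \<in> point_configurations M. emeasure \<mu> A \<in> B}"
    by auto
  moreover have "{\<mu> \<in> point_configurations M. emeasure \<mu> A \<in> B} \<in>
      sets (configuration_space M)"
    unfolding configuration_space_def using assms B by (intro in_measure_of) auto
  ultimately show "(\<lambda>N. emeasure N A) -` B \<inter> space (configuration_space M)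
      \<in> sets (configuration_space M)"
    by simp
qed simp

text \<open>Counts are extended reals, so other values have to be excluded first: since
  \<open>p\<close> sums to 1, both variables are almost surely natural numbers. The mass of a Borel
  set is then the sum of \<open>p k\<close> over the \<open>k\<close> in it.\<close>

lemma distr_eqI_nat_valued:
  fixes X :: "'a \<Rightarrow> ennreal" and Y :: "'b \<Rightarrow> ennreal" and p :: "nat \<Rightarrow> real"
  assumes P: "prob_space P" and Q: "prob_space Q"
    and X [measurable]: "X \<in> borel_measurable P" and Y [measurable]: "Y \<in> borel_measurable Q"
    and Xp: "\<And>k. measure P {\<omega> \<in> space P. X \<omega> = of_nat k} = p k"
    and Yp: "\<And>k. measure Q {\<omega> \<in> space Q. Y \<omega> = of_nat k} = p k"
    and p: "p sums 1"
  shows "distr P borel X = distr Q borel Y"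
proof (rule measure_eqI)
  fix B assume "B \<in> sets (distr P borel X)"
  then have B: "B \<in> sets borel" by simp
  have *: "(\<lambda>k. if of_nat k \<in> B then p k else 0) sums measure (distr M borel Z) B"
    if M: "prob_space M" and Z [measurable]: "Z \<in> borel_measurable M"
      and Zp: "\<And>k. measure M {\<omega> \<in> space M. Z \<omega> = of_nat k} = p k"
    for M :: "'c measure" and Z
  proof -
    interpret D: prob_space "distr M borel Z"
      by (rule prob_space.prob_space_distr[OF M Z])
    have disj: "disjoint_family (\<lambda>k::nat. C \<inter> {of_nat k :: ennreal})" for C
      by (auto simp: disjoint_family_on_def)
    have s: "measure (distr M borel Z) {of_nat k} = p k" for k
    proof -
      have "Z -` {of_nat k} \<inter> space M = {\<omega> \<in> space M. Z \<omega> = of_nat k}" by auto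
      then show ?thesis using Zp[of k] by (subst measure_distr) auto
    qed
    have "(\<lambda>k::nat. measure (distr M borel Z) (UNIV \<inter> {of_nat k})) sums
        measure (distr M borel Z) (\<Union>k. UNIV \<inter> {of_nat k})"
      by (rule D.finite_measure_UNION[OF _ disj]) auto
    then have "p sums measure (distr M borel Z) (range of_nat)"
      by (simp add: s UNION_singleton_eq_range)
    then have "measure (distr M borel Z) (range of_nat) = 1"
      using p sums_unique2 by blast
    then have AE: "AE x in distr M borel Z. x \<in> range of_nat"
      by (subst D.AE_in_set_eq_1) (auto intro: sets.countable)
    have "(\<lambda>k. measure (distr M borel Z) (B \<inter> {of_nat k})) sums
        measure (distr M borel Z) (\<Union>k. B \<inter> {of_nat k})"
      by (rule D.finite_measure_UNION[OF _ disj]) (use B in auto)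
    also have "measure (distr M borel Z) (\<Union>k. B \<inter> {of_nat k}) = measure (distr M borel Z) B"
      by (rule D.finite_measure_eq_AE) (use AE B in auto)
    also have "(\<lambda>k. measure (distr M borel Z) (B \<inter> {of_nat k})) =
        (\<lambda>k. if of_nat k \<in> B then p k else 0)"
      by (auto simp: s)
    finally show ?thesis .
  qed
  interpret DP: prob_space "distr P borel X" by (rule prob_space.prob_space_distr[OF P X])
  interpret DQ: prob_space "distr Q borel Y" by (rule prob_space.prob_space_distr[OF Q Y])
  have "measure (distr P borel X) B = measure (distr Q borel Y) B"
    using sums_unique2[OF *[OF P X Xp] *[OF Q Y Yp]] by simp
  then show "emeasure (distr P borel X) B = emeasure (distr Q borel Y) B"
    by (simp add: DP.emeasure_eq_measure DQ.emeasure_eq_measure)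
qed simp

lemma poisson_process_law_measurable_count:
  assumes "poisson_process_law \<Lambda> P" "A \<in> sets \<Lambda>"
  shows "(\<lambda>N. emeasure N A) \<in> borel_measurable P"
  using measurable_count[OF assms(2)] assms(1)
  unfolding poisson_process_law_def by (metis measurable_cong_sets)

lemma poisson_process_law_space:
  assumes "poisson_process_law \<Lambda> P"
  shows "space P = point_configurations \<Lambda>"
  using assms sets_eq_imp_space_eq[of P "configuration_space \<Lambda>"]
  unfolding poisson_process_law_def by simp

lemma point_configurations_sets:
  assumes "N \<in> point_configurations M"
  shows "sets N = sets M"
  using assms unfolding point_configurations_def by simp

text \<open>The definition of the law gives independence for sequences of sets. The family is
  enumerated by \<open>g\<close> and padded with empty sets, and the product formula is pulled back
  along the injection \<open>g\<close>.\<close>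

lemma poisson_process_law_indep_vars:
  assumes P: "poisson_process_law \<Lambda> P"
    and J: "finite J" and a: "\<And>j. j \<in> J \<Longrightarrow> a j \<in> sets \<Lambda>" "disjoint_family_on a J"
  shows "prob_space.indep_vars P (\<lambda>_. borel) (\<lambda>j N. emeasure N (a j)) J"
proof -
  interpret prob_space P using P by (simp add: poisson_process_law_def)
  obtain g where g: "bij_betw g J {0..<card J}"
    using ex_bij_betw_finite_nat[OF J] by auto
  define b where "b i = (if i < card J then a (the_inv_into J g i) else {})" for i
  have inj: "inj_on g J" and lt: "\<And>j. j \<in> J \<Longrightarrow> g j < card J"
    using g by (auto simp: bij_betw_def)
  have inv: "the_inv_into J g i \<in> J" if "i < card J" for i
    using that g by (auto simp: bij_betw_def intro!: the_inv_into_into)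
  have inv': "g (the_inv_into J g i) = i" if "i < card J" for i
    using that g by (auto simp: bij_betw_def intro!: f_the_inv_into_f)
  have bg: "b (g j) = a j" if "j \<in> J" for j
    using that lt inj by (simp add: b_def the_inv_into_f_f)
  have "range b \<subseteq> sets \<Lambda>"
    using a inv by (auto simp: b_def)
  moreover have "disjoint_family b"
  proof -
    have "b i \<inter> b k = {}" if "i \<noteq> k" for i k
      using that inv[of i] inv[of k] inv'[of i] inv'[of k] a(2)
      by (auto simp: b_def disjoint_family_on_def split: if_splits)
         (metis IntI empty_iff)
    then show ?thesis by (auto simp: disjoint_family_on_def)
  qed
  ultimately have ind: "indep_vars (\<lambda>_. borel) (\<lambda>i N. emeasure N (b i)) UNIV"
    using P by (simp add: poisson_process_law_def)
  show ?thesis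
    unfolding indep_vars_def2
  proof (intro conjI ballI indep_setsI)
    fix j assume "j \<in> J"
    then show rv: "random_variable borel (\<lambda>N. emeasure N (a j))"
      using poisson_process_law_measurable_count[OF P] a by auto
    then show "{(\<lambda>N. emeasure N (a j)) -` A \<inter> space P |A. A \<in> sets borel} \<subseteq> events"
      by (auto intro: measurable_sets)
  next
    fix A K
    assume K: "K \<noteq> {}" "K \<subseteq> J" "finite K"
      and A: "\<forall>j\<in>K. A j \<in> {(\<lambda>N. emeasure N (a j)) -` A \<inter> space P |A. A \<in> sets borel}"
    from A have "\<forall>j\<in>K. \<exists>B. B \<in> sets borel \<and> A j = (\<lambda>N. emeasure N (a j)) -` B \<inter> space P"
      by blast
    then obtain B where B: "\<And>j. j \<in> K \<Longrightarrow> B j \<in> sets borel"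
      "\<And>j. j \<in> K \<Longrightarrow> A j = (\<lambda>N. emeasure N (a j)) -` B j \<inter> space P"
      by metis
    define B' where "B' i = B (the_inv_into J g i)" for i
    have injK: "inj_on g K" using inj K(2) inj_on_subset by blast
    have B'g: "B' (g j) = B j" if "j \<in> K" for j
      using that K inj by (auto simp: B'_def the_inv_into_f_f subset_iff)
    have "prob (\<Inter>i\<in>g ` K. (\<lambda>N. emeasure N (b i)) -` B' i \<inter> space P) =
        (\<Prod>i\<in>g ` K. prob ((\<lambda>N. emeasure N (b i)) -` B' i \<inter> space P))"
      using K B B'g by (intro indep_varsD[OF ind]) auto
    then have "prob (\<Inter>j\<in>K. (\<lambda>N. emeasure N (b (g j))) -` B' (g j) \<inter> space P) =
        (\<Prod>j\<in>K. prob ((\<lambda>N. emeasure N (b (g j))) -` B' (g j) \<inter> space P))"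
      by (simp add: prod.reindex[OF injK] image_image)
    moreover have "A j = (\<lambda>N. emeasure N (b (g j))) -` B' (g j) \<inter> space P" if "j \<in> K" for j
      using that K B(2) B'g bg by auto
    ultimately show "prob (\<Inter>j\<in>K. A j) = (\<Prod>j\<in>K. prob (A j))"
      by simp
  qed
qed

lemma poisson_process_law_count_distr_eq:
  assumes P: "poisson_process_law \<Lambda> P" and Q: "poisson_process_law \<Lambda> Q"
    and A: "A \<in> sets \<Lambda>" "emeasure \<Lambda> A < \<infinity>"
  shows "distr P borel (\<lambda>N. emeasure N A) = distr Q borel (\<lambda>N. emeasure N A)"
proof (rule distr_eqI_nat_valued)
  show "prob_space P" "prob_space Q" using P Q by (auto simp: poisson_process_law_def)
  show "(\<lambda>N. emeasure N A) \<in> borel_measurable P" "(\<lambda>N. emeasure N A) \<in> borel_measurable Q"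
    using poisson_process_law_measurable_count P Q A by blast+
  show "measure P {N \<in> space P. emeasure N A = of_nat k} =
      exp (- measure \<Lambda> A) * measure \<Lambda> A ^ k / fact k"
    "measure Q {N \<in> space Q. emeasure N A = of_nat k} =
      exp (- measure \<Lambda> A) * measure \<Lambda> A ^ k / fact k" for k :: nat
    using P Q A by (auto simp: poisson_process_law_def)
  \<comment> \<open>The Poisson weights have total mass 1, so a count of finite intensity is almost
    surely finite.\<close>
  have "(\<lambda>k. exp (- measure \<Lambda> A) * (measure \<Lambda> A ^ k /\<^sub>R fact k)) sums
      (exp (- measure \<Lambda> A) * exp (measure \<Lambda> A))"
    by (intro sums_mult exp_converges)
  then show "(\<lambda>k. exp (- measure \<Lambda> A) * measure \<Lambda> A ^ k / fact k) sums 1"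
    by (simp add: exp_minus field_simps)
qed

text \<open>
  The counts of finitely many sets are functions of the independent counts of the atoms of the
  finite algebra they generate.
\<close>

lemma poisson_process_law_joint_counts_eq:
  assumes P: "poisson_process_law \<Lambda> P" and Q: "poisson_process_law \<Lambda> Q"
    and F: "finite F" "\<And>A. A \<in> F \<Longrightarrow> A \<in> sets \<Lambda>" "\<And>A. A \<in> F \<Longrightarrow> emeasure \<Lambda> A < \<infinity>"
    and B: "\<And>A. A \<in> F \<Longrightarrow> B A \<in> sets borel"
  shows "emeasure P {N \<in> space P. \<forall>A\<in>F. emeasure N A \<in> B A} =
    emeasure Q {N \<in> space Q. \<forall>A\<in>F. emeasure N A \<in> B A}"
proof (cases "F = {}")
  case True
  then show ?thesis
    using P Q by (simp add: poisson_process_law_def prob_space.emeasure_space_1)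
next
  case False
  \<comment> \<open>The empty \<open>S\<close> is left out: its atom is the complement of the union
    of \<open>F\<close> and may have infinite intensity.\<close>
  define J where "J = Pow F - {{}}"
  define atom where "atom S = {x \<in> space \<Lambda>. \<forall>A\<in>F. x \<in> A \<longleftrightarrow> A \<in> S}" for S
  have J: "finite J" "J \<noteq> {}" using F(1) False by (auto simp: J_def)
  have atom_sets: "atom S \<in> sets \<Lambda>" for S
  proof -
    have "{x \<in> space \<Lambda>. x \<in> A \<longleftrightarrow> A \<in> S} \<in> sets \<Lambda>" if "A \<in> F" for A
    proof (cases "A \<in> S")
      case True
      then have "{x \<in> space \<Lambda>. x \<in> A \<longleftrightarrow> A \<in> S} = A"
        using sets.sets_into_space[OF F(2)[OF that]] by auto
      then show ?thesis using F(2)[OF that] by simp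
    next
      case False
      then have "{x \<in> space \<Lambda>. x \<in> A \<longleftrightarrow> A \<in> S} = space \<Lambda> - A" by auto
      then show ?thesis using F(2)[OF that] by auto
    qed
    then show ?thesis
      unfolding atom_def using F(1) by (intro sets.sets_Collect_finite_All') (use False in auto)
  qed
  have disj: "disjoint_family_on atom K" if KF: "K \<subseteq> Pow F" for K
    unfolding disjoint_family_on_def
  proof (intro ballI impI)
    fix S T assume ST: "S \<in> K" "T \<in> K" "S \<noteq> T"
    then obtain A where A: "A \<in> F" "A \<in> S \<longleftrightarrow> A \<notin> T"
      using KF by blast
    have False if "x \<in> atom S" "x \<in> atom T" for x
      using that A unfolding atom_def by blast
    then show "atom S \<inter> atom T = {}" by blast
  qed
  have atom_fin: "emeasure \<Lambda> (atom S) < \<infinity>" if "S \<in> J" for S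
  proof -
    obtain A where "A \<in> S" "A \<in> F" using \<open>S \<in> J\<close> by (auto simp: J_def)
    then have "atom S \<subseteq> A" by (auto simp: atom_def)
    then have "emeasure \<Lambda> (atom S) \<le> emeasure \<Lambda> A"
      using F(2) \<open>A \<in> F\<close> by (intro emeasure_mono) auto
    then show ?thesis using F(3)[OF \<open>A \<in> F\<close>] by (rule le_less_trans)
  qed
  have cover: "A = (\<Union>S\<in>{S\<in>J. A \<in> S}. atom S)" if "A \<in> F" for A
  proof (intro equalityI subsetI)
    fix x assume "x \<in> A"
    then have "x \<in> atom {A \<in> F. x \<in> A}"
      using sets.sets_into_space[OF F(2)[OF that]] by (auto simp: atom_def)
    moreover have "{A \<in> F. x \<in> A} \<in> {S\<in>J. A \<in> S}"
      using that \<open>x \<in> A\<close> by (auto simp: J_def)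
    ultimately show "x \<in> (\<Union>S\<in>{S\<in>J. A \<in> S}. atom S)" by blast
  qed (use that in \<open>auto simp: atom_def\<close>)
  \<comment> \<open>\<open>X N\<close> is the vector of atom counts, and \<open>E\<close> collects
    the vectors whose sums over the atoms inside each \<open>A\<close> satisfy the constraints, so
    the event in question is the preimage of \<open>E\<close>. By independence the law of
    \<open>X\<close> is a product of marginals, and these agree for \<open>P\<close> and
    \<open>Q\<close>.\<close>
  define X where "X N = (\<lambda>S\<in>J. emeasure N (atom S))" for N
  define E where "E = {x \<in> space (\<Pi>\<^sub>M S\<in>J. (borel :: ennreal measure)).
      \<forall>A\<in>F. (\<Sum>S\<in>{S\<in>J. A \<in> S}. x S) \<in> B A}"
  have E: "E \<in> sets (\<Pi>\<^sub>M S\<in>J. borel)"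
  proof -
    have "{x \<in> space (\<Pi>\<^sub>M S\<in>J. (borel :: ennreal measure)). (\<Sum>S\<in>{S\<in>J. A \<in> S}. x S) \<in> B A}
        \<in> sets (\<Pi>\<^sub>M S\<in>J. borel)" if "A \<in> F" for A
    proof -
      have "(\<lambda>x. \<Sum>S\<in>{S\<in>J. A \<in> S}. x S) \<in> borel_measurable (\<Pi>\<^sub>M S\<in>J. (borel :: ennreal measure))"
        by (intro borel_measurable_sum measurable_component_singleton) auto
      from measurable_sets[OF this B[OF that]] show ?thesis
        by (simp add: vimage_def Int_def conj_commute)
    qed
    then show ?thesis
      unfolding E_def using F(1) False by (intro sets.sets_Collect_finite_All') auto
  qed
  have *: "emeasure M {N \<in> space M. \<forall>A\<in>F. emeasure N A \<in> B A} =
      emeasure (\<Pi>\<^sub>M S\<in>J. distr M borel (\<lambda>N. emeasure N (atom S))) E"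
    if M: "poisson_process_law \<Lambda> M" for M
  proof -
    interpret prob_space M using M by (simp add: poisson_process_law_def)
    have rv: "(\<lambda>N. emeasure N (atom S)) \<in> borel_measurable M" for S
      by (rule poisson_process_law_measurable_count[OF M atom_sets])
    have X: "X \<in> measurable M (\<Pi>\<^sub>M S\<in>J. borel)"
      unfolding X_def using rv by (intro measurable_restrict)
    have "emeasure N A = (\<Sum>S\<in>{S\<in>J. A \<in> S}. X N S)" if "N \<in> space M" "A \<in> F" for N A
    proof -
      have N: "sets N = sets \<Lambda>"
        using that poisson_process_law_space[OF M] point_configurations_sets by auto
      have "emeasure N A = emeasure N (\<Union>S\<in>{S\<in>J. A \<in> S}. atom S)"
        using cover[OF \<open>A \<in> F\<close>] by simp
      also have "\<dots> = (\<Sum>S\<in>{S\<in>J. A \<in> S}. emeasure N (atom S))"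
        using J(1) N atom_sets disj[of "{S\<in>J. A \<in> S}"]
        by (intro sum_emeasure[symmetric]) (auto simp: J_def)
      finally show ?thesis by (simp add: X_def)
    qed
    then have "{N \<in> space M. \<forall>A\<in>F. emeasure N A \<in> B A} = X -` E \<inter> space M"
      using measurable_space[OF X] by (auto simp: E_def)
    then have "emeasure M {N \<in> space M. \<forall>A\<in>F. emeasure N A \<in> B A} =
        emeasure (distr M (\<Pi>\<^sub>M S\<in>J. borel) X) E"
      using X E by (simp add: emeasure_distr)
    also have "distr M (\<Pi>\<^sub>M S\<in>J. borel) X =
        (\<Pi>\<^sub>M S\<in>J. distr M borel (\<lambda>N. emeasure N (atom S)))"
      unfolding X_def
      using poisson_process_law_indep_vars[OF M J(1) atom_sets disj] J rv
      by (subst indep_vars_iff_distr_eq_PiM[symmetric]) (auto simp: J_def)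
    finally show ?thesis .
  qed
  have "(\<Pi>\<^sub>M S\<in>J. distr P borel (\<lambda>N. emeasure N (atom S))) =
      (\<Pi>\<^sub>M S\<in>J. distr Q borel (\<lambda>N. emeasure N (atom S)))"
    using poisson_process_law_count_distr_eq[OF P Q atom_sets atom_fin] by (intro PiM_cong) auto
  then show ?thesis using *[OF P] *[OF Q] by simp
qed

text \<open>A pi-lambda argument on the events that constrain finitely many counts of sets of finite
  intensity. Sigma-finiteness ensures that these events also generate the counts of sets of infinite
  intensity.\<close>

theorem poisson_process_law_unique:
  assumes \<Lambda>: "sigma_finite_measure \<Lambda>"
    and P: "poisson_process_law \<Lambda> P" and Q: "poisson_process_law \<Lambda> Q"
  shows "P = Q"
proof -
  define \<Omega> where "\<Omega> = point_configurations \<Lambda>"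
  define \<F> where "\<F> = {A \<in> sets \<Lambda>. emeasure \<Lambda> A < \<infinity>}"
  define E where "E = {{N \<in> \<Omega>. \<forall>A\<in>F. emeasure N A \<in> B A} | F B.
      finite F \<and> F \<subseteq> \<F> \<and> range B \<subseteq> sets (borel :: ennreal measure)}"
  have EI: "{N \<in> \<Omega>. \<forall>A\<in>F. emeasure N A \<in> B A} \<in> E"
    if "finite F" "F \<subseteq> \<F>" "\<And>A. B A \<in> sets borel" for F B
    unfolding E_def using that by blast
  have \<Omega>E: "\<Omega> \<in> E" using EI[of "{}" "\<lambda>_. UNIV"] by simp
  have EPow: "E \<subseteq> Pow \<Omega>" by (auto simp: E_def)
  have spP: "space P = \<Omega>" and spQ: "space Q = \<Omega>"
    using poisson_process_law_space P Q by (auto simp: \<Omega>_def)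
  have "Int_stable E"
  proof (rule Int_stableI)
    fix X Y assume "X \<in> E" "Y \<in> E"
    then obtain F B G D where F: "finite F" "F \<subseteq> \<F>" "range B \<subseteq> sets (borel :: ennreal measure)"
      and G: "finite G" "G \<subseteq> \<F>" "range D \<subseteq> sets (borel :: ennreal measure)"
      and XY: "X = {N \<in> \<Omega>. \<forall>A\<in>F. emeasure N A \<in> B A}" "Y = {N \<in> \<Omega>. \<forall>A\<in>G. emeasure N A \<in> D A}"
      unfolding E_def by blast
    \<comment> \<open>A set constrained on one side only gets the vacuous constraint
      \<open>UNIV\<close> on the other, so one family over \<open>F \<union> G\<close> describes the
      intersection.\<close>
    have "X \<inter> Y = {N \<in> \<Omega>. \<forall>A\<in>F \<union> G. emeasure N A \<in>
        (if A \<in> F then B A else UNIV) \<inter> (if A \<in> G then D A else UNIV)}"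
      unfolding XY by auto
    also have "\<dots> \<in> E"
      using F G by (intro EI) (auto intro!: sets.Int)
    finally show "X \<inter> Y \<in> E" .
  qed
  have sets_eq: "sets (configuration_space \<Lambda>) = sigma_sets \<Omega> E"
  proof (rule antisym)
    have sub: "E \<subseteq> sets (configuration_space \<Lambda>)"
    proof
      fix X assume "X \<in> E"
      then obtain F B where F: "finite F" "F \<subseteq> \<F>" "range B \<subseteq> sets (borel :: ennreal measure)"
        and X: "X = {N \<in> \<Omega>. \<forall>A\<in>F. emeasure N A \<in> B A}"
        unfolding E_def by blast
      have "{N \<in> \<Omega>. emeasure N A \<in> B A} \<in> sets (configuration_space \<Lambda>)" if "A \<in> F" for A
      proof -
        have "(\<lambda>N. emeasure N A) -` B A \<inter> space (configuration_space \<Lambda>)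
            \<in> sets (configuration_space \<Lambda>)"
          using F that by (intro measurable_sets[OF measurable_count]) (auto simp: \<F>_def)
        then show ?thesis by (simp add: \<Omega>_def vimage_def Int_def conj_commute)
      qed
      then show "X \<in> sets (configuration_space \<Lambda>)"
        unfolding X using F(1) sets.sets_Collect_finite_All[of F "configuration_space \<Lambda>"]
        by (simp add: \<Omega>_def)
    qed
    show "sigma_sets \<Omega> E \<subseteq> sets (configuration_space \<Lambda>)"
      using sets.sigma_sets_subset[OF sub] by (simp add: \<Omega>_def)
    interpret sigma_finite_measure \<Lambda> by fact
    obtain W :: "nat \<Rightarrow> 'a set" where W: "range W \<subseteq> sets \<Lambda>" "(\<Union>i. W i) = space \<Lambda>"
      "\<And>i. emeasure \<Lambda> (W i) \<noteq> \<infinity>" "incseq W"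
      using sigma_finite_incseq by blast
    \<comment> \<open>The pieces \<open>A \<inter> W i\<close> have finite intensity and increase to
      \<open>A\<close>, so the count of \<open>A\<close> is a supremum of counts already known to be
      measurable.\<close>
    have meas: "(\<lambda>N. emeasure N A) \<in> borel_measurable (sigma \<Omega> E)" if A: "A \<in> sets \<Lambda>" for A
    proof -
      have "(\<lambda>N. emeasure N (A \<inter> W i)) \<in> borel_measurable (sigma \<Omega> E)" for i
      proof (rule measurableI)
        fix B :: "ennreal set" assume B: "B \<in> sets borel"
        have "emeasure \<Lambda> (A \<inter> W i) \<le> emeasure \<Lambda> (W i)"
          using W(1) by (intro emeasure_mono) auto
        then have "A \<inter> W i \<in> \<F>"
          using A W(1) W(3)[of i] by (auto simp: \<F>_def less_top top_unique)
        then have "{N \<in> \<Omega>. \<forall>A\<in>{A \<inter> W i}. emeasure N A \<in> B} \<in> E"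
          using B by (intro EI) auto
        moreover have "(\<lambda>N. emeasure N (A \<inter> W i)) -` B \<inter> space (sigma \<Omega> E) =
            {N \<in> \<Omega>. \<forall>A\<in>{A \<inter> W i}. emeasure N A \<in> B}"
          using EPow by (auto simp: space_measure_of_conv)
        ultimately show "(\<lambda>N. emeasure N (A \<inter> W i)) -` B \<inter> space (sigma \<Omega> E)
            \<in> sets (sigma \<Omega> E)"
          using EPow by (auto intro: in_measure_of)
      qed simp
      then have "(\<lambda>N. SUP i. emeasure N (A \<inter> W i)) \<in> borel_measurable (sigma \<Omega> E)"
        by (intro borel_measurable_SUP) auto
      moreover have "(SUP i. emeasure N (A \<inter> W i)) = emeasure N A"
        if "N \<in> space (sigma \<Omega> E)" for N
      proof -
        have "sets N = sets \<Lambda>"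
          using that point_configurations_sets by (auto simp: space_measure_of_conv \<Omega>_def)
        then have "(SUP i. emeasure N (A \<inter> W i)) = emeasure N (\<Union>i. A \<inter> W i)"
          using A W(1,4) by (intro SUP_emeasure_incseq) (auto simp: incseq_def, blast)
        also have "(\<Union>i. A \<inter> W i) = A"
          using W(2) sets.sets_into_space[OF A] by auto
        finally show ?thesis .
      qed
      ultimately show ?thesis by (subst measurable_cong[of _ _ "\<lambda>N. SUP i. emeasure N (A \<inter> W i)"]) auto
    qed
    have "{\<mu> \<in> point_configurations \<Lambda>. emeasure \<mu> A \<in> B} \<in> sigma_sets \<Omega> E"
      if "A \<in> sets \<Lambda>" "B \<in> sets borel" for A and B :: "ennreal set"
      using measurable_sets[OF meas[OF that(1)] that(2)] EPow
      by (simp add: \<Omega>_def vimage_def Int_def conj_commute space_measure_of_conv)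
    then show "sets (configuration_space \<Lambda>) \<subseteq> sigma_sets \<Omega> E"
      unfolding configuration_space_def
      by (subst sets_measure_of) (auto simp flip: \<Omega>_def intro!: sigma_sets_mono)
  qed
  show ?thesis
  proof (rule measure_eqI_generator_eq[OF \<open>Int_stable E\<close> EPow])
    fix X assume "X \<in> E"
    then obtain F B where F: "finite F" "F \<subseteq> \<F>" "range B \<subseteq> sets (borel :: ennreal measure)"
      and X: "X = {N \<in> \<Omega>. \<forall>A\<in>F. emeasure N A \<in> B A}"
      unfolding E_def by blast
    show "emeasure P X = emeasure Q X"
      using poisson_process_law_joint_counts_eq[OF P Q F(1), of B] F(2,3)
      by (auto simp: X spP spQ \<F>_def)
  next
    show "sets P = sigma_sets \<Omega> E" "sets Q = sigma_sets \<Omega> E"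
      using P Q sets_eq by (auto simp: poisson_process_law_def)
    show "range (\<lambda>_::nat. \<Omega>) \<subseteq> E" "(\<Union>i::nat. \<Omega>) = \<Omega>" using \<Omega>E by auto
    show "emeasure P \<Omega> \<noteq> \<infinity>"
      using P spP prob_space.emeasure_space_1[of P] by (simp add: poisson_process_law_def)
  qed
qed

subsection \<open>Conditioning on a void\<close>

text \<open>For \<open>D\<close> of finite intensity the factor
  \<open>exp (measure \<Lambda> D)\<close> is the reciprocal of the void probability, so this is the
  conditional law given no point in \<open>D\<close>. Written as a density, it displays the
  likelihood ratio with respect to \<open>P\<close>.\<close>

definition void_conditioning :: "'a measure \<Rightarrow> 'a measure measure \<Rightarrow> 'a set \<Rightarrow> 'a measure measure" where
  "void_conditioning \<Lambda> P D =
     density P (\<lambda>N. ennreal (exp (measure \<Lambda> D)) * indicator {N \<in> space P. emeasure N D = 0} N)"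

lemma void_event_measurable:
  assumes "poisson_process_law \<Lambda> P" "D \<in> sets \<Lambda>"
  shows "{N \<in> space P. emeasure N D = 0} \<in> sets P"
  using poisson_process_law_measurable_count[OF assms] by measurable

lemma emeasure_void_conditioning:
  assumes P: "poisson_process_law \<Lambda> P" "D \<in> sets \<Lambda>" and X: "X \<in> sets P"
  shows "emeasure (void_conditioning \<Lambda> P D) X =
    ennreal (exp (measure \<Lambda> D)) * emeasure P (X \<inter> {N \<in> space P. emeasure N D = 0})"
proof -
  have [measurable]: "{N \<in> space P. emeasure N D = 0} \<in> sets P" "X \<in> sets P"
    using void_event_measurable[OF P] X by auto
  have "emeasure (void_conditioning \<Lambda> P D) X =
      (\<integral>\<^sup>+N. ennreal (exp (measure \<Lambda> D)) *
        indicator (X \<inter> {N \<in> space P. emeasure N D = 0}) N \<partial>P)"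
    unfolding void_conditioning_def
    by (subst emeasure_density) (auto intro!: nn_integral_cong simp: indicator_def)
  also have "\<dots> = ennreal (exp (measure \<Lambda> D)) *
      emeasure P (X \<inter> {N \<in> space P. emeasure N D = 0})"
    by (subst nn_integral_cmult_indicator) auto
  finally show ?thesis .
qed

lemma poisson_process_law_void_prob:
  assumes P: "poisson_process_law \<Lambda> P" and D: "D \<in> sets \<Lambda>" "emeasure \<Lambda> D < \<infinity>"
  shows "measure P {N \<in> space P. emeasure N D = 0} = exp (- measure \<Lambda> D)"
proof -
  have "measure P {N \<in> space P. emeasure N D = of_nat 0} =
      exp (- measure \<Lambda> D) * measure \<Lambda> D ^ 0 / fact 0"
    using P D unfolding poisson_process_law_def by blast
  then show ?thesis by simp
qed

text \<open>
  Given that there is no point in \<open>D\<close>, the counts of the sets \<open>A j\<close> are those of the sets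
  \<open>A j - D\<close>, which are independent of the count of \<open>D\<close>.
\<close>

lemma void_conditioning_joint_counts:
  assumes P: "poisson_process_law \<Lambda> P" and D: "D \<in> sets \<Lambda>" "emeasure \<Lambda> D < \<infinity>"
    and J: "finite (J :: nat set)" and A: "\<And>j. j \<in> J \<Longrightarrow> A j \<in> sets \<Lambda>" "disjoint_family_on A J"
    and B: "\<And>j. j \<in> J \<Longrightarrow> B j \<in> sets borel"
  shows "emeasure (void_conditioning \<Lambda> P D) {N \<in> space P. \<forall>j\<in>J. emeasure N (A j) \<in> B j} =
    ennreal (\<Prod>j\<in>J. measure P {N \<in> space P. emeasure N (A j - D) \<in> B j})"
proof -
  interpret prob_space P using P by (simp add: poisson_process_law_def)
  have [measurable]: "(\<lambda>N. emeasure N (A j)) \<in> borel_measurable P" if "j \<in> J" for j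
    using poisson_process_law_measurable_count[OF P] A that by auto
  let ?X = "{N \<in> space P. \<forall>j\<in>J. emeasure N (A j) \<in> B j}"
  let ?V = "{N \<in> space P. emeasure N D = 0}"
  have "{N \<in> space P. emeasure N (A j) \<in> B j} \<in> events" if "j \<in> J" for j
    using measurable_sets[OF _ B[OF that], of "\<lambda>N. emeasure N (A j)" P] that
    by (simp add: vimage_def Int_def conj_commute)
  then have X: "?X \<in> events"
    using J by (intro sets.sets_Collect_finite_All) auto
  \<comment> \<open>Index 0 carries \<open>D\<close> with the event that its count is 0, and
    \<open>Suc j\<close> carries \<open>A j - D\<close>. This single family is disjoint, so
    independence applies to all of it at once.\<close>
  define a where "a = case_nat D (\<lambda>j. A j - D)"
  define b where "b = case_nat {0} B"
  let ?I = "insert 0 (Suc ` J)"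
  have "N \<in> ?X \<inter> ?V \<longleftrightarrow> N \<in> (\<Inter>i\<in>?I. (\<lambda>N. emeasure N (a i)) -` b i \<inter> space P)" for N
  proof (cases "N \<in> ?V")
    case True
    then have N: "sets N = sets \<Lambda>"
      using poisson_process_law_space[OF P] point_configurations_sets by auto
    \<comment> \<open>On the void event \<open>D\<close> is a null set of \<open>N\<close>, so
      removing it changes no count.\<close>
    have "emeasure N (A j - D) = emeasure N (A j)" if "j \<in> J" for j
    proof -
      have "D \<in> null_sets N"
        using True D(1) N by (intro null_setsI) auto
      then have "D \<inter> A j \<in> null_sets N"
        using A(1)[OF that] N by (intro null_set_Int2) auto
      then have "emeasure N (A j - (D \<inter> A j)) = emeasure N (A j)"
        using A(1)[OF that] N by (intro emeasure_Diff_null_set) auto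
      moreover have "A j - (D \<inter> A j) = A j - D" by auto
      ultimately show ?thesis by simp
    qed
    then show ?thesis using True by (auto simp: a_def b_def)
  qed (auto simp: a_def b_def)
  then have "?X \<inter> ?V = (\<Inter>i\<in>?I. (\<lambda>N. emeasure N (a i)) -` b i \<inter> space P)"
    by (rule set_eqI)
  then have "prob (?X \<inter> ?V) = prob (\<Inter>i\<in>?I. (\<lambda>N. emeasure N (a i)) -` b i \<inter> space P)"
    by (rule arg_cong)
  also have "\<dots> = (\<Prod>i\<in>?I. prob ((\<lambda>N. emeasure N (a i)) -` b i \<inter> space P))"
  proof (rule indep_varsD)
    have "x \<notin> A k" if "x \<in> A j" "j \<in> J" "k \<in> J" "j \<noteq> k" for x j k
      using that disjoint_family_onD[OF A(2), of j k] by auto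
    then have "disjoint_family_on a ?I"
      by (auto simp: disjoint_family_on_def a_def)
    then show "indep_vars (\<lambda>_. borel) (\<lambda>i N. emeasure N (a i)) ?I"
      using J A(1) D(1) by (intro poisson_process_law_indep_vars[OF P]) (auto simp: a_def)
    show "b i \<in> sets borel" if "i \<in> ?I" for i
      using that B by (auto simp: b_def)
  qed (use J in auto)
  also have "\<dots> = prob ?V * (\<Prod>j\<in>J. prob {N \<in> space P. emeasure N (A j - D) \<in> B j})"
    using J by (simp add: prod.reindex a_def b_def vimage_def Int_def conj_commute)
  finally have "prob (?X \<inter> ?V) =
      exp (- measure \<Lambda> D) * (\<Prod>j\<in>J. prob {N \<in> space P. emeasure N (A j - D) \<in> B j})"
    using poisson_process_law_void_prob[OF P D] by simp
  then have "exp (measure \<Lambda> D) * prob (?X \<inter> ?V) =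
      (\<Prod>j\<in>J. prob {N \<in> space P. emeasure N (A j - D) \<in> B j})"
    by (simp add: exp_minus)
  then show ?thesis
    by (simp add: emeasure_void_conditioning[OF P D(1) X] emeasure_eq_measure flip: ennreal_mult')
qed

text \<open>The product formula for the conditioned joint counts is used twice. For one set it says
  that the count of \<open>A\<close> is distributed as that of \<open>A - D\<close> under
  \<open>P\<close>, hence is Poisson with the reduced intensity; for several disjoint sets it gives
  independence.\<close>

theorem poisson_process_law_void_conditioning:
  assumes P: "poisson_process_law \<Lambda> P" and D: "D \<in> sets \<Lambda>" "emeasure \<Lambda> D < \<infinity>"
  shows "poisson_process_law (density \<Lambda> (indicator (space \<Lambda> - D))) (void_conditioning \<Lambda> P D)"
proof -
  interpret P: prob_space P using P by (simp add: poisson_process_law_def)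
  define Q where "Q = void_conditioning \<Lambda> P D"
  define \<Lambda>' where "\<Lambda>' = density \<Lambda> (indicator (space \<Lambda> - D))"
  have sQ: "sets Q = sets P" "space Q = space P"
    by (auto simp: Q_def void_conditioning_def)
  have s\<Lambda>: "sets \<Lambda>' = sets \<Lambda>" by (simp add: \<Lambda>'_def)
  \<comment> \<open>The empty family of sets yields total mass 1.\<close>
  have "{N \<in> space P. \<forall>j\<in>({} :: nat set). emeasure N ((\<lambda>_. {}) j) \<in> (\<lambda>_. UNIV) j} = space P"
    by simp
  then have "emeasure Q (space Q) = 1"
    using void_conditioning_joint_counts[OF P D, of "{}" "\<lambda>_. {}" "\<lambda>_. UNIV"]
    by (simp add: Q_def sQ[unfolded Q_def] disjoint_family_on_def)
  then interpret Q: prob_space Q by (rule prob_spaceI)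
  have joint: "measure Q {N \<in> space P. \<forall>j\<in>J. emeasure N (A j) \<in> B j} =
      (\<Prod>j\<in>J. measure P {N \<in> space P. emeasure N (A j - D) \<in> B j})"
    if "finite J" "\<And>j. j \<in> J \<Longrightarrow> A j \<in> sets \<Lambda>" "disjoint_family_on A J"
      "\<And>j. j \<in> J \<Longrightarrow> B j \<in> sets borel" for J :: "nat set" and A B
    using void_conditioning_joint_counts[OF P D that]
    by (simp add: measure_def Q_def prod_nonneg)
  have single: "measure Q {N \<in> space P. emeasure N A \<in> B} =
      measure P {N \<in> space P. emeasure N (A - D) \<in> B}"
    if "A \<in> sets \<Lambda>" "B \<in> sets borel" for A B
    using joint[of "{0}" "\<lambda>_. A" "\<lambda>_. B"] that by (simp add: disjoint_family_on_def)
  have \<Lambda>': "emeasure \<Lambda>' A = emeasure \<Lambda> (A - D)" if "A \<in> sets \<Lambda>" for A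
  proof -
    have "emeasure \<Lambda>' A = (\<integral>\<^sup>+x. indicator (space \<Lambda> - D) x * indicator A x \<partial>\<Lambda>)"
      unfolding \<Lambda>'_def using that D(1) by (subst emeasure_density) auto
    also have "\<dots> = (\<integral>\<^sup>+x. indicator (A - D) x \<partial>\<Lambda>)"
      by (intro nn_integral_cong) (simp split: split_indicator)
    finally have "emeasure \<Lambda>' A = (\<integral>\<^sup>+x. indicator (A - D) x \<partial>\<Lambda>)" .
    then show ?thesis using that D(1) by simp
  qed
  have "poisson_process_law \<Lambda>' Q"
    unfolding poisson_process_law_def
  proof (intro conjI ballI allI impI)
    show "prob_space Q" by unfold_locales
    show "sets Q = sets (configuration_space \<Lambda>')"
      using P sQ configuration_space_cong[OF s\<Lambda>] by (simp add: poisson_process_law_def)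
  next
    fix A and k :: nat assume A: "A \<in> sets \<Lambda>'" "emeasure \<Lambda>' A < \<infinity>"
    have "measure Q {N \<in> space Q. emeasure N A = of_nat k} =
        measure P {N \<in> space P. emeasure N (A - D) = of_nat k}"
      using single[of A "{of_nat k}"] A s\<Lambda> sQ by simp
    also have "\<dots> = exp (- measure \<Lambda> (A - D)) * measure \<Lambda> (A - D) ^ k / fact k"
      using P A D(1) s\<Lambda> \<Lambda>' unfolding poisson_process_law_def by auto
    also have "measure \<Lambda> (A - D) = measure \<Lambda>' A"
      using \<Lambda>' A s\<Lambda> by (simp add: measure_def)
    finally show "measure Q {N \<in> space Q. emeasure N A = of_nat k} =
      exp (- measure \<Lambda>' A) * measure \<Lambda>' A ^ k / fact k" .
  next
    fix A :: "nat \<Rightarrow> 'a set"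
    assume "range A \<subseteq> sets \<Lambda>'" and disj: "disjoint_family A"
    then have A: "A j \<in> sets \<Lambda>" for j using s\<Lambda> by auto
    show "Q.indep_vars (\<lambda>_. borel) (\<lambda>i N. emeasure N (A i)) UNIV"
      unfolding Q.indep_vars_def2
    proof (intro conjI ballI Q.indep_setsI)
      fix j
      show rv: "Q.random_variable borel (\<lambda>N. emeasure N (A j))"
        using poisson_process_law_measurable_count[OF P A] measurable_cong_sets[OF sQ(1) refl]
        by auto
      then show "{(\<lambda>N. emeasure N (A j)) -` B \<inter> space Q |B. B \<in> sets borel} \<subseteq> Q.events"
        by (auto intro: measurable_sets)
    next
      fix X and J :: "nat set"
      assume J: "J \<noteq> {}" "J \<subseteq> UNIV" "finite J"
        and X: "\<forall>j\<in>J. X j \<in> {(\<lambda>N. emeasure N (A j)) -` B \<inter> space Q |B. B \<in> sets borel}"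
      from X have "\<forall>j\<in>J. \<exists>B. B \<in> sets borel \<and> X j = (\<lambda>N. emeasure N (A j)) -` B \<inter> space Q"
        by blast
      then obtain B where B: "\<And>j. j \<in> J \<Longrightarrow> B j \<in> sets borel"
        "\<And>j. j \<in> J \<Longrightarrow> X j = (\<lambda>N. emeasure N (A j)) -` B j \<inter> space Q"
        by metis
      have X': "X j = {N \<in> space P. emeasure N (A j) \<in> B j}" if "j \<in> J" for j
        using B(2)[OF that] sQ by auto
      have "(\<Inter>j\<in>J. X j) = {N \<in> space P. \<forall>j\<in>J. emeasure N (A j) \<in> B j}"
        using J(1) X' by auto
      then have "Q.prob (\<Inter>j\<in>J. X j) =
          (\<Prod>j\<in>J. P.prob {N \<in> space P. emeasure N (A j - D) \<in> B j})"
        using joint[of J A B] J A B(1) disj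
        by (auto simp: disjoint_family_on_def)
      also have "\<dots> = (\<Prod>j\<in>J. Q.prob (X j))"
        using single[OF A B(1)] X' by (intro prod.cong) auto
      finally show "Q.prob (\<Inter>j\<in>J. X j) = (\<Prod>j\<in>J. Q.prob (X j))" .
    qed
  qed
  then show ?thesis by (simp add: Q_def \<Lambda>'_def)
qed

section \<open>Second-moment inequalities for conditioning and for the mean squared error\<close>

text \<open>Cauchy-Schwarz for the likelihood ratio \<open>L\<close>, the normalised indicator of
  \<open>V\<close>: the difference of expectations is the covariance of \<open>T\<close> and
  \<open>L\<close>, and \<open>L\<close> has variance \<open>1 / prob V - 1\<close>, which is at
  most \<open>w\<close>. The proof uses that the mean square of \<open>T - m - t * (L - 1)\<close>
  is nonnegative for every \<open>t\<close>.\<close>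

lemma (in prob_space) conditional_expectation_diff_le_variance:
  fixes T :: "'a \<Rightarrow> real"
  assumes T [measurable]: "T \<in> borel_measurable M" and T2: "integrable M (\<lambda>x. (T x)\<^sup>2)"
    and V [measurable]: "V \<in> events" and p: "prob V > 0" and w: "1 / prob V \<le> 1 + w" "w > 0"
  shows "(expectation (\<lambda>x. T x * (indicator V x / prob V)) - expectation T)\<^sup>2 \<le> w * variance T"
proof -
  define L where "L = (\<lambda>x. indicator V x / prob V)"
  define m where "m = expectation T"
  define d where "d = expectation (\<lambda>x. T x * L x) - m"
  have T1: "integrable M T" by (rule square_integrable_imp_integrable[OF T T2])
  have L1: "integrable M L" and EL: "expectation L = 1"
    using p by (auto simp: L_def less_top[symmetric]
        intro!: Bochner_Integration.integrable_divide integrable_real_indicator)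
  have TL: "integrable M (\<lambda>x. T x * L x)"
    using integrable_real_mult_indicator[OF V T1] unfolding L_def
    by (simp add: field_simps)
  have L2: "L x * L x = L x / prob V" for x
    by (simp add: L_def indicator_def)
  have pos: "0 \<le> variance T - 2 * t * d + t\<^sup>2 * (1 / prob V - 1)" for t
  proof -
    have "0 \<le> expectation (\<lambda>x. (T x - m - t * (L x - 1))\<^sup>2)" by simp
    also have "(\<lambda>x. (T x - m - t * (L x - 1))\<^sup>2) =
        (\<lambda>x. (T x)\<^sup>2 - 2 * m * T x + m\<^sup>2 - 2 * t * (T x * L x - T x - m * L x + m)
          + t\<^sup>2 * (L x / prob V - 2 * L x + 1))"
      by (auto simp: power2_eq_square algebra_simps simp flip: L2)
    also have "expectation \<dots> = expectation (\<lambda>x. (T x)\<^sup>2) - 2 * m * m + m\<^sup>2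
        - 2 * t * (expectation (\<lambda>x. T x * L x) - m - m * 1 + m) + t\<^sup>2 * (1 / prob V - 2 * 1 + 1)"
      using T1 T2 L1 TL EL by (simp add: m_def prob_space)
    also have "\<dots> = variance T - 2 * t * d + t\<^sup>2 * (1 / prob V - 1)"
      using variance_eq[OF T1 T2] by (simp add: d_def m_def power2_eq_square algebra_simps)
    finally show ?thesis .
  qed
  \<comment> \<open>\<open>t = d / w\<close> minimises the quadratic once
    \<open>1 / prob V - 1\<close> is replaced by its bound \<open>w\<close>.\<close>
  have "0 \<le> variance T - 2 * (d / w) * d + (d / w)\<^sup>2 * (1 / prob V - 1)"
    by (rule pos)
  also have "\<dots> \<le> variance T - 2 * (d / w) * d + (d / w)\<^sup>2 * w"
    using w by (intro add_left_mono mult_left_mono) auto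
  also have "\<dots> = variance T - d\<^sup>2 / w"
    using w by (simp add: power2_eq_square field_simps)
  finally have "d\<^sup>2 \<le> w * variance T"
    using w by (simp add: field_simps)
  then show ?thesis by (simp add: d_def m_def L_def)
qed

text \<open>The void probability is at least \<open>exp (- v)\<close>, so the preceding inequality
  applies with \<open>w = exp v - 1\<close>. A positive bound \<open>v\<close> in place of the
  intensity of \<open>D\<close> keeps \<open>w\<close> positive when \<open>D\<close> is
  null.\<close>

lemma void_conditioning_expectation_diff_le_variance:
  assumes P: "poisson_process_law \<Lambda> P" and D: "D \<in> sets \<Lambda>" "emeasure \<Lambda> D \<le> ennreal v" "v > 0"
    and T [measurable]: "T \<in> borel_measurable P" and T2: "integrable P (\<lambda>N. (T N :: real)\<^sup>2)"
  shows "(prob_space.expectation (void_conditioning \<Lambda> P D) T - prob_space.expectation P T)\<^sup>2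
    \<le> (exp v - 1) * prob_space.variance P T"
proof -
  interpret prob_space P using P by (simp add: poisson_process_law_def)
  have fin: "emeasure \<Lambda> D < \<infinity>"
    using D(2) by (rule order.strict_trans1) simp
  have v: "measure \<Lambda> D \<le> v"
    using D(2,3) by (simp add: measure_def enn2real_leI)
  define V where "V = {N \<in> space P. emeasure N D = 0}"
  have V [measurable]: "V \<in> events"
    unfolding V_def by (rule void_event_measurable[OF P D(1)])
  have pV: "prob V = 1 / exp (measure \<Lambda> D)"
    using poisson_process_law_void_prob[OF P D(1) fin]
    by (simp add: V_def exp_minus inverse_eq_divide)
  have "void_conditioning \<Lambda> P D = density P (\<lambda>N. ennreal (indicator V N / prob V))"
    unfolding void_conditioning_def V_def[symmetric]
    by (intro arg_cong[of _ _ "density P"]) (auto simp: pV fun_eq_iff indicator_def)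
  then have "prob_space.expectation (void_conditioning \<Lambda> P D) T =
      expectation (\<lambda>N. T N * (indicator V N / prob V))"
    by (simp add: integral_real_density mult.commute)
  moreover have "1 / prob V \<le> 1 + (exp v - 1)" "prob V > 0" "exp v - 1 > 0"
    using v D(3) by (auto simp: pV)
  ultimately show ?thesis
    using conditional_expectation_diff_le_variance[OF T T2 V, of "exp v - 1"] by simp
qed

text \<open>Finiteness of the extended integral makes \<open>T\<close> square integrable. The error
  then splits into variance plus squared bias, and each of the two is at most the whole.\<close>

lemma mean_squared_error_bounds:
  assumes P: "prob_space P" and T [measurable]: "T \<in> borel_measurable P"
    and MSE: "MSE P T \<theta> < ennreal (u\<^sup>2)" and u: "u \<ge> 0"
  shows "integrable P (\<lambda>N. (T N)\<^sup>2)" "prob_space.variance P T \<le> u\<^sup>2" "\<bar>bias P T \<theta>\<bar> \<le> u"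
proof -
  interpret prob_space P by fact
  have fin: "(\<integral>\<^sup>+N. ennreal ((T N - \<theta>)\<^sup>2) \<partial>P) < \<infinity>"
    using MSE unfolding MSE_def by (rule order.strict_trans) simp
  have i2: "integrable P (\<lambda>N. (T N - \<theta>)\<^sup>2)"
  proof (rule integrableI_nonneg)
    show "(\<lambda>N. (T N - \<theta>)\<^sup>2) \<in> borel_measurable P" by measurable
    show "AE N in P. 0 \<le> (T N - \<theta>)\<^sup>2" by simp
    show "(\<integral>\<^sup>+N. ennreal ((T N - \<theta>)\<^sup>2) \<partial>P) < \<infinity>" by (rule fin)
  qed
  have i1: "integrable P (\<lambda>N. T N - \<theta>)"
    by (rule square_integrable_imp_integrable) (use i2 in auto)
  then have iT: "integrable P T"
    using Bochner_Integration.integrable_add[OF i1, of "\<lambda>_. \<theta>"] by simp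
  have "integrable P (\<lambda>N. (T N - \<theta>)\<^sup>2 + 2 * \<theta> * T N - \<theta>\<^sup>2)"
    using i2 iT by simp
  then show T2: "integrable P (\<lambda>N. (T N)\<^sup>2)"
    by (simp add: power2_diff algebra_simps)
  have "ennreal (expectation (\<lambda>N. (T N - \<theta>)\<^sup>2)) < ennreal (u\<^sup>2)"
    using MSE i2 by (simp add: MSE_def nn_integral_eq_integral)
  then have le: "expectation (\<lambda>N. (T N - \<theta>)\<^sup>2) \<le> u\<^sup>2"
    by (simp add: ennreal_less_iff)
  have "expectation (\<lambda>N. (T N - \<theta>)\<^sup>2) = variance T + (bias P T \<theta>)\<^sup>2"
  proof -
    have "expectation (\<lambda>N. (T N - \<theta>)\<^sup>2) = expectation (\<lambda>N. (T N)\<^sup>2 + \<theta>\<^sup>2 - 2 * \<theta> * T N)"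
      by (simp add: power2_diff algebra_simps)
    also have "\<dots> = expectation (\<lambda>N. (T N)\<^sup>2) + \<theta>\<^sup>2 - 2 * \<theta> * expectation T"
      using T2 iT by (simp add: prob_space)
    finally show ?thesis
      using variance_eq[OF iT T2] by (simp add: bias_def power2_eq_square algebra_simps)
  qed
  moreover have "variance T \<ge> 0" "(bias P T \<theta>)\<^sup>2 \<ge> 0" by simp_all
  ultimately have var: "variance T \<le> u\<^sup>2" and b: "(bias P T \<theta>)\<^sup>2 \<le> u\<^sup>2"
    using le by linarith+
  show "variance T \<le> u\<^sup>2" by (rule var)
  show "\<bar>bias P T \<theta>\<bar> \<le> u"
    using b u abs_le_square_iff[of "bias P T \<theta>" u] by simp
qed


subsection \<open>Hoelder balls\<close>

text \<open>After division by \<open>s = a + b\<close> both terms lie in the unit interval, where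
  \<open>c \<le> c powr \<beta>\<close>, and they add up to 1.\<close>

lemma powr_add_le_add_powr:
  fixes a b \<beta> :: real
  assumes "0 \<le> a" "0 \<le> b" "0 < \<beta>" "\<beta> \<le> 1"
  shows "(a + b) powr \<beta> \<le> a powr \<beta> + b powr \<beta>"
proof (cases "a + b = 0")
  case True
  then show ?thesis using assms by simp
next
  case False
  define s where "s = a + b"
  have s: "s > 0" using False assms by (simp add: s_def)
  have *: "c / s \<le> (c / s) powr \<beta>" if "0 \<le> c" "c \<le> s" for c
    using that s powr_mono'[of \<beta> 1 "c / s"] assms by simp
  have "1 = a / s + b / s" using s by (simp add: s_def flip: add_divide_distrib)
  also have "\<dots> \<le> (a / s) powr \<beta> + (b / s) powr \<beta>"
    using assms by (intro add_mono *) (auto simp: s_def)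
  also have "\<dots> = (a powr \<beta> + b powr \<beta>) / s powr \<beta>"
    using assms s by (simp add: powr_divide add_divide_distrib)
  finally show ?thesis using s by (simp add: s_def field_simps)
qed

lemma abs_diff_powr_le:
  fixes a b \<beta> :: real
  assumes "0 \<le> a" "0 \<le> b" "0 < \<beta>" "\<beta> \<le> 1"
  shows "\<bar>a powr \<beta> - b powr \<beta>\<bar> \<le> \<bar>a - b\<bar> powr \<beta>"
proof -
  have *: "c powr \<beta> \<le> d powr \<beta> + \<bar>c - d\<bar> powr \<beta>" if "0 \<le> c" "0 \<le> d" for c d
  proof -
    have "c powr \<beta> \<le> (d + \<bar>c - d\<bar>) powr \<beta>"
      using that assms by (intro powr_mono2) auto
    also have "\<dots> \<le> d powr \<beta> + \<bar>c - d\<bar> powr \<beta>"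
      using that assms by (intro powr_add_le_add_powr) auto
    finally show ?thesis .
  qed
  show ?thesis using *[of a b] *[of b a] assms by (simp add: abs_minus_commute abs_le_iff)
qed

text \<open>For \<open>h > 0\<close> this is the rescaled kernel
  \<open>h powr \<beta> * K ((x - x\<^sub>0) / h)\<close> with
  \<open>K y = max 0 (1 - \<bar>y\<bar> powr \<beta>)\<close>. Its Hoelder constant stays at most 1
  for every width \<open>h\<close>.\<close>

definition bump :: "real \<Rightarrow> real \<Rightarrow> real \<Rightarrow> real \<Rightarrow> real" where
  "bump \<beta> h x\<^sub>0 x = max 0 (h powr \<beta> - \<bar>x - x\<^sub>0\<bar> powr \<beta>)"

lemma bump_nonneg: "0 \<le> bump \<beta> h x\<^sub>0 x"
  and bump_center: "\<beta> > 0 \<Longrightarrow> bump \<beta> h x\<^sub>0 x\<^sub>0 = h powr \<beta>"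
  and bump_le: "bump \<beta> h x\<^sub>0 x \<le> h powr \<beta>"
  by (auto simp: bump_def)

text \<open>Enclosing the bump in a rectangle of area \<open>2 * h powr (\<beta> + 1)\<close>
  replaces the computation of its integral; only constants are lost.\<close>

lemma bump_le_indicator:
  assumes "\<beta> > 0" "h > 0"
  shows "bump \<beta> h x\<^sub>0 x \<le> h powr \<beta> * indicator {x\<^sub>0 - h..x\<^sub>0 + h} x"
proof (cases "\<bar>x - x\<^sub>0\<bar> \<le> h")
  case True
  then have "x \<in> {x\<^sub>0 - h..x\<^sub>0 + h}" by auto
  then show ?thesis using bump_le[of \<beta> h x\<^sub>0 x] by simp
next
  case False
  then have "h powr \<beta> \<le> \<bar>x - x\<^sub>0\<bar> powr \<beta>" using assms by (intro powr_mono2) auto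
  then show ?thesis by (simp add: bump_def)
qed

text \<open>Truncation at 0 and the distance to \<open>x\<^sub>0\<close> are 1-Lipschitz, and the
  power between them is Hoelder with constant 1.\<close>

lemma bump_hoelder:
  assumes "0 < \<beta>" "\<beta> \<le> 1"
  shows "\<bar>bump \<beta> h x\<^sub>0 x - bump \<beta> h x\<^sub>0 y\<bar> \<le> \<bar>x - y\<bar> powr \<beta>"
proof -
  have "\<bar>max 0 (a - b) - max 0 (a - c)\<bar> \<le> \<bar>b - c\<bar>" for a b c :: real
    by linarith
  then have "\<bar>bump \<beta> h x\<^sub>0 x - bump \<beta> h x\<^sub>0 y\<bar> \<le> \<bar>\<bar>x - x\<^sub>0\<bar> powr \<beta> - \<bar>y - x\<^sub>0\<bar> powr \<beta>\<bar>"
    unfolding bump_def .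
  also have "\<dots> \<le> \<bar>\<bar>x - x\<^sub>0\<bar> - \<bar>y - x\<^sub>0\<bar>\<bar> powr \<beta>"
    using assms by (intro abs_diff_powr_le) auto
  also have "\<dots> \<le> \<bar>x - y\<bar> powr \<beta>"
    using assms by (intro powr_mono2) auto
  finally show ?thesis .
qed

lemma hoelder_norm_bump_le:
  assumes "0 < \<beta>" "\<beta> \<le> 1"
  shows "hoelder_norm \<beta> D (bump \<beta> h x\<^sub>0) \<le> ennreal (h powr \<beta> + 1)"
proof -
  have "(SUP x\<in>D. ennreal \<bar>bump \<beta> h x\<^sub>0 x\<bar>) \<le> ennreal (h powr \<beta>)"
    using bump_nonneg bump_le by (intro SUP_least ennreal_leI) auto
  moreover have "(SUP (x, y)\<in>{(x, y). x \<in> D \<and> y \<in> D \<and> x \<noteq> y}.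
      ennreal (\<bar>bump \<beta> h x\<^sub>0 x - bump \<beta> h x\<^sub>0 y\<bar> / \<bar>x - y\<bar> powr \<beta>)) \<le> 1"
    using bump_hoelder[OF assms] by (intro SUP_least) (auto simp: divide_le_eq)
  ultimately show ?thesis
    unfolding hoelder_norm_def by (simp add: add_mono)
qed

lemma hoelder_norm_add_le:
  "hoelder_norm \<beta> D (\<lambda>x. f x + g x) \<le> hoelder_norm \<beta> D f + hoelder_norm \<beta> D g"
proof -
  let ?I = "{(x, y). x \<in> D \<and> y \<in> D \<and> x \<noteq> y}"
  let ?s = "\<lambda>f. SUP x\<in>D. ennreal \<bar>f x\<bar>"
  let ?q = "\<lambda>f (x, y). ennreal (\<bar>f x - f y\<bar> / \<bar>x - y\<bar> powr \<beta>)"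
  have "?s (\<lambda>x. f x + g x) \<le> ?s f + ?s g"
  proof (rule SUP_least)
    fix x assume x: "x \<in> D"
    have "ennreal \<bar>f x + g x\<bar> \<le> ennreal \<bar>f x\<bar> + ennreal \<bar>g x\<bar>"
      by (auto simp flip: ennreal_plus intro!: ennreal_leI)
    also have "\<dots> \<le> ?s f + ?s g"
      using x by (intro add_mono SUP_upper)
    finally show "ennreal \<bar>f x + g x\<bar> \<le> ?s f + ?s g" .
  qed
  moreover have "(SUP p\<in>?I. ?q (\<lambda>x. f x + g x) p) \<le> (SUP p\<in>?I. ?q f p) + (SUP p\<in>?I. ?q g p)"
  proof (rule SUP_least)
    fix p assume p: "p \<in> ?I"
    obtain x y where xy: "p = (x, y)" by (cases p)
    have "\<bar>f x + g x - (f y + g y)\<bar> / \<bar>x - y\<bar> powr \<beta>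
        \<le> (\<bar>f x - f y\<bar> + \<bar>g x - g y\<bar>) / \<bar>x - y\<bar> powr \<beta>"
      by (intro divide_right_mono) auto
    then have "?q (\<lambda>x. f x + g x) p \<le> ?q f p + ?q g p"
      by (auto simp: xy add_divide_distrib simp flip: ennreal_plus intro!: ennreal_leI)
    also have "\<dots> \<le> (SUP p\<in>?I. ?q f p) + (SUP p\<in>?I. ?q g p)"
      using p by (intro add_mono SUP_upper)
    finally show "?q (\<lambda>x. f x + g x) p \<le> (SUP p\<in>?I. ?q f p) + (SUP p\<in>?I. ?q g p)" .
  qed
  ultimately have "hoelder_norm \<beta> D (\<lambda>x. f x + g x) \<le>
      (?s f + ?s g) + ((SUP p\<in>?I. ?q f p) + (SUP p\<in>?I. ?q g p))"
    unfolding hoelder_norm_def by (rule add_mono)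
  also have "\<dots> = hoelder_norm \<beta> D f + hoelder_norm \<beta> D g"
    unfolding hoelder_norm_def by (simp only: ac_simps)
  finally show ?thesis .
qed

lemma hoelder_ball_add_bump:
  assumes "0 < \<beta>" "\<beta> \<le> 1" "f \<in> hoelder_ball \<beta> r" "0 \<le> r" "r + h powr \<beta> + 1 \<le> R"
  shows "(\<lambda>x. f x + bump \<beta> h x\<^sub>0 x) \<in> hoelder_ball \<beta> R"
proof -
  have "hoelder_norm \<beta> {0..1} (\<lambda>x. f x + bump \<beta> h x\<^sub>0 x) \<le> ennreal r + ennreal (h powr \<beta> + 1)"
    using hoelder_norm_add_le[of \<beta> "{0..1}" f "bump \<beta> h x\<^sub>0"] assms(3)
      add_mono[OF _ hoelder_norm_bump_le[OF assms(1,2)]]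
    unfolding hoelder_ball_def by (blast intro: order_trans)
  also have "\<dots> = ennreal (r + (h powr \<beta> + 1))"
    using assms by (intro ennreal_plus[symmetric]) auto
  also have "\<dots> \<le> ennreal R"
    using assms by (intro ennreal_leI) auto
  finally show ?thesis by (simp add: hoelder_ball_def)
qed

text \<open>Supplies the measurability of the boundary on the strip. Continuity is confined to the
  unit interval, since the norm controls nothing outside it.\<close>

lemma hoelder_ball_continuous_on:
  assumes f: "f \<in> hoelder_ball \<beta> r" and "0 < \<beta>" "0 \<le> r"
  shows "continuous_on {0..1} f"
proof -
  have H: "\<bar>f x - f y\<bar> \<le> r * \<bar>x - y\<bar> powr \<beta>" if "x \<in> {0..1}" "y \<in> {0..1}" for x y
  proof (cases "x = y")
    case False
    let ?I = "{(x, y). x \<in> {0..1::real} \<and> y \<in> {0..1} \<and> x \<noteq> y}"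
    let ?q = "\<lambda>(x, y). ennreal (\<bar>f x - f y\<bar> / \<bar>x - y\<bar> powr \<beta>)"
    have "?q (x, y) \<le> (SUP p\<in>?I. ?q p)"
      using that False by (intro SUP_upper) auto
    also have "\<dots> \<le> hoelder_norm \<beta> {0..1} f"
      unfolding hoelder_norm_def by simp
    also have "\<dots> \<le> ennreal r" using f by (simp add: hoelder_ball_def)
    finally have "\<bar>f x - f y\<bar> / \<bar>x - y\<bar> powr \<beta> \<le> r"
      using assms by simp
    then show ?thesis using False by (simp add: divide_le_eq)
  qed simp
  show ?thesis
    unfolding continuous_on_def
  proof
    fix a :: real assume a: "a \<in> {0..1}"
    have "((\<lambda>x. r * \<bar>x - a\<bar> powr \<beta>) \<longlongrightarrow> r * \<bar>a - a\<bar> powr \<beta>) (at a within {0..1})"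
      using assms by (intro tendsto_intros) auto
    then have "((\<lambda>x. r * \<bar>x - a\<bar> powr \<beta>) \<longlongrightarrow> 0) (at a within {0..1})" by simp
    then have "((\<lambda>x. f x - f a) \<longlongrightarrow> 0) (at a within {0..1})"
      by (rule Lim_null_comparison[rotated]) (use H a in \<open>auto simp: eventually_at_filter\<close>)
    then show "(f \<longlongrightarrow> f a) (at a within {0..1})"
      by (simp add: LIM_zero_cancel)
  qed
qed

text \<open>The constraint \<open>K 0 = 1\<close> forces the supremum norm of every kernel to be at
  least 1. The bound leaves room in the ball of radius \<open>R\<close> for a bump of norm at most
  2.\<close>

lemma kappa_ge_2:
  assumes "0 < \<beta>" "\<beta> < 1"
  shows "kappa \<beta> \<ge> 2"
proof -
  have "1 \<le> (INF K\<in>kernels. hoelder_norm \<beta> UNIV K)"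
  proof (rule INF_greatest)
    fix K assume "K \<in> kernels"
    then have "1 = ennreal \<bar>K 0\<bar>" by (simp add: kernels_def)
    also have "\<dots> \<le> (SUP x. ennreal \<bar>K x\<bar>)" by (intro SUP_upper) auto
    also have "\<dots> \<le> hoelder_norm \<beta> UNIV K" unfolding hoelder_norm_def by simp
    finally show "1 \<le> hoelder_norm \<beta> UNIV K" .
  qed
  then have "enn2real 1 \<le> enn2real (INF K\<in>kernels. hoelder_norm \<beta> UNIV K)"
    using kernel_infimum_finite[OF assms] by (intro enn2real_mono) auto
  then show ?thesis by (simp add: kappa_def)
qed

subsection \<open>Two-point bounds in the boundary model\<close>

lemma space_strip: "space strip = {0..1} \<times> UNIV"
  by (simp add: strip_def space_restrict_space)

lemma measurable_boundary_strip:
  assumes "continuous_on {0..1} f"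
  shows "(\<lambda>p. f (fst p)) \<in> borel_measurable strip"
proof -
  have "continuous_on ({0..1} \<times> (UNIV :: real set)) (\<lambda>p. f (fst p))"
    by (intro continuous_on_compose2[OF assms] continuous_intros) auto
  then have "(\<lambda>p. f (fst p)) \<in> borel_measurable (restrict_space borel ({0..1} \<times> (UNIV :: real set)))"
    by (rule borel_measurable_continuous_on_restrict)
  moreover have "sets strip = sets (restrict_space borel ({0..1} \<times> UNIV))"
    unfolding strip_def by (rule sets_restrict_space_cong) simp
  ultimately show ?thesis by (simp cong: measurable_cong_sets)
qed

lemma measurable_snd_strip: "snd \<in> borel_measurable strip"
  unfolding strip_def
  by (rule measurable_restrict_space1)
    (simp add: borel_measurable_continuous_onI continuous_on_snd)

lemma unit_interval_times_UNIV_borel: "{0..1::real} \<times> (UNIV :: real set) \<in> sets borel"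
  by (intro borel_closed closed_Times) auto

lemma sets_boundary_intensity: "sets (boundary_intensity n f) = sets strip"
  by (simp add: boundary_intensity_def)

lemma sigma_finite_strip: "sigma_finite_measure strip"
  unfolding strip_def
  by (rule sigma_finite_measure_restrict_space[OF sigma_finite_lborel])
    (simp add: unit_interval_times_UNIV_borel)

lemma measurable_boundary_density:
  assumes "continuous_on {0..1} f"
  shows "(\<lambda>(x, y). ennreal (n * (if f x \<le> y then 1 else 0))) \<in> borel_measurable strip"
proof -
  note [measurable] = measurable_boundary_strip[OF assms] measurable_snd_strip
  show ?thesis unfolding case_prod_beta by measurable
qed

lemma sigma_finite_boundary_intensity:
  assumes "continuous_on {0..1} f"
  shows "sigma_finite_measure (boundary_intensity n f)"
  unfolding boundary_intensity_def
  by (rule iffD2[OF sigma_finite_measure.sigma_finite_iff_density_finite'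
        [OF sigma_finite_strip measurable_boundary_density[OF assms]]]) auto

text \<open>The half-open form matches the closed condition \<open>f x \<le> y\<close> in the
  intensity: for \<open>f \<le> g\<close>, removing the gap leaves exactly the points with
  \<open>g x \<le> y\<close>.\<close>

definition boundary_gap :: "(real \<Rightarrow> real) \<Rightarrow> (real \<Rightarrow> real) \<Rightarrow> (real \<times> real) set" where
  "boundary_gap f g = {p \<in> space strip. f (fst p) \<le> snd p \<and> snd p < g (fst p)}"

context
  fixes n :: real and f g :: "real \<Rightarrow> real"
  assumes f: "continuous_on {0..1} f" and g: "continuous_on {0..1} g"
    and fg: "\<And>x. f x \<le> g x"
begin

lemma boundary_gap_measurable: "boundary_gap f g \<in> sets strip"
proof -
  note [measurable] = measurable_boundary_strip[OF f] measurable_boundary_strip[OF g]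
    measurable_snd_strip
  show ?thesis unfolding boundary_gap_def by measurable
qed

lemma density_boundary_intensity_gap:
  "density (boundary_intensity n f) (indicator (space (boundary_intensity n f) - boundary_gap f g)) =
    boundary_intensity n g"
proof -
  have sp: "space (boundary_intensity n f) = space strip"
    by (simp add: boundary_intensity_def)
  have ind: "(indicator (space strip - boundary_gap f g) :: _ \<Rightarrow> ennreal) \<in> borel_measurable strip"
    using boundary_gap_measurable by simp
  have "density (boundary_intensity n f) (indicator (space (boundary_intensity n f) - boundary_gap f g)) =
      density strip (\<lambda>p. (case p of (x, y) \<Rightarrow> ennreal (n * (if f x \<le> y then 1 else 0))) *
        indicator (space strip - boundary_gap f g) p)"
    unfolding sp unfolding boundary_intensity_def
    by (rule density_density_eq[OF measurable_boundary_density[OF f] ind])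
  also have "\<dots> = boundary_intensity n g"
    unfolding boundary_intensity_def
  proof (rule density_cong)
    show "AE p in strip. (case p of (x, y) \<Rightarrow> ennreal (n * (if f x \<le> y then 1 else 0))) *
        indicator (space strip - boundary_gap f g) p =
        (case p of (x, y) \<Rightarrow> ennreal (n * (if g x \<le> y then 1 else 0)))"
    proof (rule AE_I2)
      fix p assume p: "p \<in> space strip"
      obtain x y where xy: "p = (x, y)" by (cases p)
      show "(case p of (x, y) \<Rightarrow> ennreal (n * (if f x \<le> y then 1 else 0))) *
          indicator (space strip - boundary_gap f g) p =
          (case p of (x, y) \<Rightarrow> ennreal (n * (if g x \<le> y then 1 else 0)))"
        using p fg[of x] by (auto simp: xy boundary_gap_def split: split_indicator)
    qed
  qed (use measurable_boundary_density[OF f] measurable_boundary_density[OF g] ind in simp_all)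
  finally show ?thesis .
qed

lemma emeasure_boundary_gap:
  "emeasure (boundary_intensity n f) (boundary_gap f g) =
    ennreal n * (\<integral>\<^sup>+x\<in>{0..1}. ennreal (g x - f x) \<partial>lborel)"
proof -
  have r: "boundary_gap f g \<in> sets (lborel :: (real \<times> real) measure)"
    using boundary_gap_measurable unfolding strip_def
    by (subst (asm) sets_restrict_space_iff) (auto simp: unit_interval_times_UNIV_borel)
  have "emeasure (boundary_intensity n f) (boundary_gap f g) =
      (\<integral>\<^sup>+p. (case p of (x, y) \<Rightarrow> ennreal (n * (if f x \<le> y then 1 else 0))) * indicator (boundary_gap f g) p \<partial>strip)"
    unfolding boundary_intensity_def
    by (rule emeasure_density[OF measurable_boundary_density[OF f] boundary_gap_measurable])
  also have "\<dots> = (\<integral>\<^sup>+p. ennreal n * indicator (boundary_gap f g) p \<partial>strip)"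
    by (intro nn_integral_cong) (auto simp: boundary_gap_def split: split_indicator)
  also have "\<dots> = ennreal n * emeasure strip (boundary_gap f g)"
    using boundary_gap_measurable by (rule nn_integral_cmult_indicator)
  also have "emeasure strip (boundary_gap f g) = emeasure lborel (boundary_gap f g)"
    unfolding strip_def by (rule emeasure_restrict_space) (auto simp: unit_interval_times_UNIV_borel boundary_gap_def space_strip)
  \<comment> \<open>Tonelli over vertical sections, each a half-open interval of length
    \<open>g x - f x\<close> or empty.\<close>
  also have "\<dots> = (\<integral>\<^sup>+x. emeasure lborel (Pair x -` (boundary_gap f g)) \<partial>lborel)"
    using r unfolding lborel_prod[symmetric] by (rule lborel.emeasure_pair_measure_alt)
  also have "\<dots> = (\<integral>\<^sup>+x\<in>{0..1}. ennreal (g x - f x) \<partial>lborel)"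
  proof (rule nn_integral_cong)
    fix x :: real
    have "Pair x -` (boundary_gap f g) = (if x \<in> {0..1} then {f x..<g x} else {})"
      by (auto simp: boundary_gap_def space_strip)
    then show "emeasure lborel (Pair x -` (boundary_gap f g)) = ennreal (g x - f x) * indicator {0..1} x"
      using fg[of x] by simp
  qed
  finally show ?thesis .
qed

text \<open>\<open>Q\<close> is an arbitrary process law with boundary \<open>g\<close>. Uniqueness
  identifies it with \<open>P\<close> conditioned on a void in the gap, so that the variance
  inequality for conditioning applies.\<close>

lemma boundary_expectation_diff_le_variance:
  assumes P: "poisson_process_law (boundary_intensity n f) P"
    and Q: "poisson_process_law (boundary_intensity n g) Q"
    and v: "ennreal n * (\<integral>\<^sup>+x\<in>{0..1}. ennreal (g x - f x) \<partial>lborel) \<le> ennreal v" "v > 0"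
    and T: "T \<in> borel_measurable P" and T2: "integrable P (\<lambda>N. (T N :: real)\<^sup>2)"
  shows "(prob_space.expectation Q T - prob_space.expectation P T)\<^sup>2
    \<le> (exp v - 1) * prob_space.variance P T"
proof -
  have D: "boundary_gap f g \<in> sets (boundary_intensity n f)"
    "emeasure (boundary_intensity n f) (boundary_gap f g) \<le> ennreal v"
    using boundary_gap_measurable v by (simp_all add: sets_boundary_intensity emeasure_boundary_gap)
  have "poisson_process_law (boundary_intensity n g)
      (void_conditioning (boundary_intensity n f) P (boundary_gap f g))"
    using poisson_process_law_void_conditioning[OF P D(1) order.strict_trans1[OF D(2)]]
    by (simp add: density_boundary_intensity_gap)
  moreover have "sigma_finite_measure (boundary_intensity n g)"
    by (rule sigma_finite_boundary_intensity[OF g])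
  ultimately have "Q = void_conditioning (boundary_intensity n f) P (boundary_gap f g)"
    using poisson_process_law_unique[OF _ Q] by blast
  then show ?thesis
    using void_conditioning_expectation_diff_le_variance[OF P D v(2) T T2] by simp
qed

end

section \<open>Scaling of the perturbation and the final lower bounds\<close>

lemma bump_expectation_diff_le_variance:
  fixes \<beta> n a r x\<^sub>0 :: real
  defines "h \<equiv> (a / n) powr (1 / (\<beta> + 1))"
  assumes \<beta>: "0 < \<beta>" "\<beta> \<le> 1" and n: "n > 0" and a: "a > 0"
    and f: "f \<in> hoelder_ball \<beta> r" "r \<ge> 0"
    and P: "poisson_process_law (boundary_intensity n f) P"
    and Q: "poisson_process_law (boundary_intensity n (\<lambda>x. f x + bump \<beta> h x\<^sub>0 x)) Q"
    and T: "T \<in> borel_measurable P" and T2: "integrable P (\<lambda>N. (T N :: real)\<^sup>2)"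
  shows "(prob_space.expectation Q T - prob_space.expectation P T)\<^sup>2
    \<le> (exp (2 * a) - 1) * prob_space.variance P T"
proof -
  let ?g = "\<lambda>x. f x + bump \<beta> h x\<^sub>0 x"
  have h: "h > 0" using a n by (simp add: h_def)
  have cf: "continuous_on {0..1} f"
    using hoelder_ball_continuous_on f \<beta> by blast
  \<comment> \<open>Membership in some Hoelder ball suffices for continuity, so the radius
    \<open>r + h powr \<beta> + 1\<close> is taken.\<close>
  have cg: "continuous_on {0..1} ?g"
    by (rule hoelder_ball_continuous_on[OF hoelder_ball_add_bump[OF \<beta> f order_refl]])
      (use \<beta> f in auto)
  have "(\<integral>\<^sup>+x\<in>{0..1}. ennreal (?g x - f x) \<partial>lborel) \<le>
      (\<integral>\<^sup>+x. ennreal (h powr \<beta>) * indicator {x\<^sub>0 - h..x\<^sub>0 + h} x \<partial>lborel)"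
  proof (rule nn_integral_mono)
    fix x
    have "ennreal (?g x - f x) * indicator {0..1} x \<le> ennreal (bump \<beta> h x\<^sub>0 x)"
      by (simp split: split_indicator)
    also have "\<dots> \<le> ennreal (h powr \<beta> * indicator {x\<^sub>0 - h..x\<^sub>0 + h} x)"
      using bump_le_indicator[OF \<beta>(1) h] by (rule ennreal_leI)
    also have "\<dots> = ennreal (h powr \<beta>) * indicator {x\<^sub>0 - h..x\<^sub>0 + h} x"
      by (simp split: split_indicator)
    finally show "ennreal (?g x - f x) * indicator {0..1} x \<le>
      ennreal (h powr \<beta>) * indicator {x\<^sub>0 - h..x\<^sub>0 + h} x" .
  qed
  also have "\<dots> = ennreal (h powr \<beta>) * ennreal (2 * h)"
    using h by (subst nn_integral_cmult_indicator) auto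
  finally have "ennreal n * (\<integral>\<^sup>+x\<in>{0..1}. ennreal (?g x - f x) \<partial>lborel) \<le>
      ennreal n * (ennreal (h powr \<beta>) * ennreal (2 * h))"
    by (rule mult_left_mono) simp
  also have "\<dots> = ennreal (n * (h powr \<beta> * (2 * h)))"
    using n h by (simp add: ennreal_mult)
  \<comment> \<open>The width \<open>h\<close> is chosen so that
    \<open>h powr (\<beta> + 1) = a / n\<close>; this cancels \<open>n\<close> from the bound on the
    gap intensity.\<close>
  also have "n * (h powr \<beta> * (2 * h)) = 2 * a"
  proof -
    have "h powr \<beta> * h = h powr (\<beta> + 1)" using h by (simp add: powr_add)
    also have "\<dots> = a / n" using \<beta> a n by (simp add: h_def powr_powr)
    finally show ?thesis using n by (simp add: field_simps)
  qed
  finally have le: "ennreal n * (\<integral>\<^sup>+x\<in>{0..1}. ennreal (?g x - f x) \<partial>lborel) \<le> ennreal (2 * a)" .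
  have fg: "f x \<le> ?g x" for x using bump_nonneg by simp
  show ?thesis
    using boundary_expectation_diff_le_variance[OF cf cg fg P Q le _ T T2] a by simp
qed

text \<open>
  The square root behaves like \<open>2 * a powr (1/2)\<close> near \<open>0\<close>, which is of smaller order than
  \<open>a powr q\<close>.
\<close>

lemma ex_small_scale:
  fixes q K :: real
  assumes q: "0 < q" "q < 1 / 2" and K: "K > 0"
  shows "\<exists>a>0. a \<le> 1 / 2 \<and> sqrt (exp (2 * a) - 1) * K \<le> a powr q / 2"
proof -
  define e where "e = 1 / 2 - q"
  \<comment> \<open>The second entry gives \<open>a powr e * K \<le> 1 / 4\<close>. The first gives
    \<open>2 * a \<le> 1\<close>, under which \<open>exp (2 * a) - 1 \<le> 4 * a\<close>.\<close>
  define a where "a = min (1 / 2) ((1 / (4 * K)) powr (1 / e))"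
  have e: "e > 0" using q by (simp add: e_def)
  have a: "a > 0" "a \<le> 1 / 2" using K by (auto simp: a_def)
  have "a powr e \<le> ((1 / (4 * K)) powr (1 / e)) powr e"
    using a e by (intro powr_mono2) (auto simp: a_def)
  also have "\<dots> = 1 / (4 * K)"
    using K e by (simp add: powr_powr)
  finally have ae: "a powr e * K \<le> 1 / 4"
    using K by (simp add: field_simps)
  have "exp (2 * a) \<le> 1 + 2 * a + (2 * a)\<^sup>2"
    using a by (intro exp_bound) auto
  moreover have "(2 * a)\<^sup>2 \<le> 2 * a"
    using a by (simp add: power2_eq_square mult_left_le)
  ultimately have "sqrt (exp (2 * a) - 1) \<le> sqrt (4 * a)"
    by (intro real_sqrt_le_mono) linarith
  also have "\<dots> = 2 * a powr (1 / 2)"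
    using a by (simp add: real_sqrt_mult powr_half_sqrt)
  also have "a powr (1 / 2) = a powr q * a powr e"
    by (simp add: e_def flip: powr_add)
  finally have "sqrt (exp (2 * a) - 1) * K \<le> 2 * (a powr q * a powr e) * K"
    using K by (intro mult_right_mono) auto
  also have "\<dots> = 2 * a powr q * (a powr e * K)" by simp
  also have "\<dots> \<le> 2 * a powr q * (1 / 4)"
    using ae by (intro mult_left_mono) auto
  finally have "sqrt (exp (2 * a) - 1) * K \<le> a powr q / 2" by simp
  then show ?thesis using a by blast
qed

text \<open>\<open>E\<^sub>0\<close> and \<open>E\<^sub>1\<close> are the expectations when the
  target is 0 and \<delta>. They differ by at most \<open>\<delta> / 2\<close>, so the two biases
  differ by at least \<open>\<delta> / 2\<close>, and one of them is at least
  \<open>\<delta> / 4\<close> in absolute value.\<close>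

lemma bias_lower_bound_two_point:
  fixes \<delta> u w E\<^sub>0 E\<^sub>1 v :: real
  assumes "(E\<^sub>1 - E\<^sub>0)\<^sup>2 \<le> w * v" "v \<le> u\<^sup>2" "sqrt w * u \<le> \<delta> / 2" "u \<ge> 0" "w \<ge> 0" "\<delta> > 0"
  shows "\<delta>\<^sup>2 / 16 \<le> E\<^sub>0\<^sup>2 \<or> \<delta>\<^sup>2 / 16 \<le> (E\<^sub>1 - \<delta>)\<^sup>2"
proof -
  have "(E\<^sub>1 - E\<^sub>0)\<^sup>2 \<le> w * u\<^sup>2"
    using assms by (meson mult_left_mono order_trans)
  also have "\<dots> = (sqrt w * u)\<^sup>2"
    using assms by (simp add: power_mult_distrib)
  finally have "\<bar>E\<^sub>1 - E\<^sub>0\<bar> \<le> sqrt w * u"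
    using assms abs_le_square_iff[of "E\<^sub>1 - E\<^sub>0" "sqrt w * u"] by simp
  then have "\<bar>\<delta> / 4\<bar> \<le> \<bar>E\<^sub>0\<bar> \<or> \<bar>\<delta> / 4\<bar> \<le> \<bar>E\<^sub>1 - \<delta>\<bar>"
    using assms by linarith
  then show ?thesis
    unfolding abs_le_square_iff by (simp add: power_divide)
qed

text \<open>All constants are fixed before \<open>n\<close>, \<open>x\<^sub>0\<close>, the laws and
  the estimator, so they depend on \<beta>, \<open>C\<close> and \<open>R\<close> only. A threshold
  is unavoidable for the variance: if \<open>R < (C / n) powr (\<beta> / (\<beta> + 1))\<close>, the
  estimator 0 meets the risk bound and has variance 0.\<close>

theorem theorem4p1:
  fixes \<beta> C R :: real
  assumes "0 < \<beta>" "\<beta> < 1" "C > 0" "R > kappa \<beta>"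
  shows "\<exists>c>0. \<exists>c'>0. \<exists>n\<^sub>0. \<forall>n::real. n \<ge> 1 \<longrightarrow>
    (\<forall>x\<^sub>0\<in>{0..1}. \<forall>P T.
      (\<forall>f\<in>hoelder_ball \<beta> R. poisson_process_law (boundary_intensity n f) (P f)) \<longrightarrow>
      T \<in> borel_measurable (configuration_space strip) \<longrightarrow>
      (SUP f\<in>hoelder_ball \<beta> R. MSE (P f) T (f x\<^sub>0)) < ennreal ((C / n) powr (2 * \<beta> / (\<beta> + 1))) \<longrightarrow>
        (SUP f\<in>hoelder_ball \<beta> R. ennreal ((bias (P f) T (f x\<^sub>0))\<^sup>2))
          \<ge> ennreal (c * n powr (- (2 * \<beta> / (\<beta> + 1)))) \<and>
        (n \<ge> n\<^sub>0 \<longrightarrow>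
          (\<forall>f\<in>hoelder_ball \<beta> ((R - kappa \<beta>) / 2).
            prob_space.variance (P f) T \<ge> c' * n powr (- (2 * \<beta> / (\<beta> + 1))))))"
proof -
  define q where "q = \<beta> / (\<beta> + 1)"
  have q: "0 < q" "q < 1 / 2" using assms by (auto simp: q_def field_simps)
  have q2: "2 * \<beta> / (\<beta> + 1) = 2 * q" by (simp add: q_def)
  have \<beta>: "0 < \<beta>" "\<beta> \<le> 1" using assms by auto
  have \<kappa>: "kappa \<beta> \<ge> 2" using kappa_ge_2 assms by blast
  \<comment> \<open>Scale for the bias: divided by \<open>n powr q\<close>, the last condition says
    that the expectations differ by at most half the separation \<open>(a / n) powr q\<close> of the
    targets.\<close>
  obtain a where a: "a > 0" "a \<le> 1 / 2" "sqrt (exp (2 * a) - 1) * C powr q \<le> a powr q / 2"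
    using ex_small_scale[OF q, of "C powr q"] assms by auto
  \<comment> \<open>Scale for the variance: the bump height \<open>(b / n) powr q\<close> is three
    times the root risk bound \<open>(C / n) powr q\<close>.\<close>
  define b where "b = C * 3 powr (1 / q)"
  have b: "b > 0" "b powr q = 3 * C powr q"
    using assms q by (auto simp: b_def powr_mult powr_powr)
  define c where "c = a powr (2 * q) / 16"
  define c' where "c' = C powr (2 * q) / (exp (2 * b) - 1)"
  have square: "(x / n) powr (2 * q) = ((x / n) powr q)\<^sup>2" for x n
    by (simp add: mult.commute[of 2] powr_powr power2_eq_square flip: powr_add)
  have scale: "(x / n) powr (2 * q) = x powr (2 * q) * n powr (- (2 * q))"
    if "x > 0" "n \<ge> 1" for x n
    using that by (simp add: powr_divide powr_minus_divide)
  have main: "ennreal (c * n powr (- (2 * q)))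
        \<le> (SUP f\<in>hoelder_ball \<beta> R. ennreal ((bias (P f) T (f x\<^sub>0))\<^sup>2)) \<and>
      (n \<ge> b \<longrightarrow> (\<forall>f\<in>hoelder_ball \<beta> ((R - kappa \<beta>) / 2).
        prob_space.variance (P f) T \<ge> c' * n powr (- (2 * q))))"
    if n: "n \<ge> 1"
      and P: "\<forall>f\<in>hoelder_ball \<beta> R. poisson_process_law (boundary_intensity n f) (P f)"
      and T: "T \<in> borel_measurable (configuration_space strip)"
      and MSE: "(SUP f\<in>hoelder_ball \<beta> R. MSE (P f) T (f x\<^sub>0)) < ennreal ((C / n) powr (2 * q))"
    for n x\<^sub>0 :: real and P T
  proof -
    define u where "u = (C / n) powr q"
    have u: "u > 0" using assms n by (simp add: u_def)
    have TP: "T \<in> borel_measurable (P f)" if "f \<in> hoelder_ball \<beta> R" for f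
    proof -
      have "sets (P f) = sets (configuration_space strip)"
        using P that configuration_space_cong[OF sets_boundary_intensity]
        by (simp add: poisson_process_law_def)
      then show ?thesis using T by (simp cong: measurable_cong_sets)
    qed
    have risk: "integrable (P f) (\<lambda>N. (T N)\<^sup>2)" "prob_space.variance (P f) T \<le> u\<^sup>2"
      "\<bar>bias (P f) T (f x\<^sub>0)\<bar> \<le> u" if f: "f \<in> hoelder_ball \<beta> R" for f
    proof -
      have "MSE (P f) T (f x\<^sub>0) \<le> (SUP f\<in>hoelder_ball \<beta> R. MSE (P f) T (f x\<^sub>0))"
        using f by (intro SUP_upper)
      then have "MSE (P f) T (f x\<^sub>0) < ennreal (u\<^sup>2)"
        using MSE by (simp add: square u_def)
      moreover have "prob_space (P f)" using P f by (simp add: poisson_process_law_def)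
      ultimately show "integrable (P f) (\<lambda>N. (T N)\<^sup>2)" "prob_space.variance (P f) T \<le> u\<^sup>2"
        "\<bar>bias (P f) T (f x\<^sub>0)\<bar> \<le> u"
        using mean_squared_error_bounds[OF _ TP[OF f]] u by (meson less_imp_le)+
    qed
    \<comment> \<open>Common to both bounds. The condition \<open>t \<le> n\<close> gives
      \<open>h \<le> 1\<close>, so the bump has norm at most 2 and \<open>r + 2 \<le> R\<close>
      keeps the perturbed boundary in the ball.\<close>
    have two_point: "(\<lambda>x. f x + bump \<beta> h x\<^sub>0 x) \<in> hoelder_ball \<beta> R \<and>
        (prob_space.expectation (P (\<lambda>x. f x + bump \<beta> h x\<^sub>0 x)) T - prob_space.expectation (P f) T)\<^sup>2
          \<le> (exp (2 * t) - 1) * prob_space.variance (P f) T \<and>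
        bump \<beta> h x\<^sub>0 x\<^sub>0 = (t / n) powr q"
      if f: "f \<in> hoelder_ball \<beta> r" "f \<in> hoelder_ball \<beta> R" "0 \<le> r" "r + 2 \<le> R"
        and t: "t > 0" "t \<le> n" and h: "h = (t / n) powr (1 / (\<beta> + 1))"
      for f r t h
    proof (intro conjI)
      have "h \<le> 1"
        using t n \<beta> by (simp add: h powr_le1)
      then have "h powr \<beta> \<le> 1"
        using \<beta> by (intro powr_le1) (auto simp: h)
      then show g: "(\<lambda>x. f x + bump \<beta> h x\<^sub>0 x) \<in> hoelder_ball \<beta> R"
        using f by (intro hoelder_ball_add_bump[OF \<beta> f(1)]) auto
      show "(prob_space.expectation (P (\<lambda>x. f x + bump \<beta> h x\<^sub>0 x)) T - prob_space.expectation (P f) T)\<^sup>2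
          \<le> (exp (2 * t) - 1) * prob_space.variance (P f) T"
        using P f g n t unfolding h
        by (intro bump_expectation_diff_le_variance[where n = n and x\<^sub>0 = x\<^sub>0, OF \<beta> _ _ f(1,3)] TP risk) auto
      show "bump \<beta> h x\<^sub>0 x\<^sub>0 = (t / n) powr q"
        using \<beta> by (simp add: bump_center h q_def powr_powr)
    qed
    show ?thesis
    proof (intro conjI impI ballI)
      \<comment> \<open>Bias: the base boundary is 0, which allows \<open>r = 0\<close>, and
        \<open>a \<le> 1 / 2\<close> with \<open>n \<ge> 1\<close> ensures \<open>a \<le> n\<close>.
        The summand 0 in \<open>g\<close> keeps the form of \<open>two_point\<close>.\<close>
      define h where "h = (a / n) powr (1 / (\<beta> + 1))"
      define g where "g = (\<lambda>x. 0 + bump \<beta> h x\<^sub>0 x)"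
      have z: "(\<lambda>_. 0) \<in> hoelder_ball \<beta> r" for r
        by (auto simp: hoelder_ball_def hoelder_norm_def split_beta bot_ennreal SUP_constant)
      have g: "g \<in> hoelder_ball \<beta> R" "g x\<^sub>0 = (a / n) powr q"
        "(prob_space.expectation (P g) T - prob_space.expectation (P (\<lambda>_. 0)) T)\<^sup>2
          \<le> (exp (2 * a) - 1) * prob_space.variance (P (\<lambda>_. 0)) T"
        using two_point[OF z z order_refl _ a(1) _ h_def] \<kappa> assms a n by (auto simp: g_def)
      have "sqrt (exp (2 * a) - 1) * u \<le> (a / n) powr q / 2"
      proof -
        have "sqrt (exp (2 * a) - 1) * C powr q / n powr q \<le> (a powr q / 2) / n powr q"
          using a(3) by (intro divide_right_mono) auto
        then show ?thesis using a assms n by (simp add: u_def powr_divide)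
      qed
      then have "((a / n) powr q)\<^sup>2 / 16 \<le> (prob_space.expectation (P (\<lambda>_. 0)) T)\<^sup>2 \<or>
          ((a / n) powr q)\<^sup>2 / 16 \<le> (prob_space.expectation (P g) T - (a / n) powr q)\<^sup>2"
        using a n u by (intro bias_lower_bound_two_point[OF g(3) risk(2)[OF z]]) auto
      moreover have "((a / n) powr q)\<^sup>2 / 16 = c * n powr (- (2 * q))"
        using a n by (simp add: c_def scale flip: square)
      \<comment> \<open>The witness is 0 or \<open>g\<close>, depending on which of the two biases
        is large.\<close>
      ultimately have "\<exists>f\<in>hoelder_ball \<beta> R. c * n powr (- (2 * q)) \<le> (bias (P f) T (f x\<^sub>0))\<^sup>2"
        using z[of R] g(1,2) unfolding bias_def by force
      then show "ennreal (c * n powr (- (2 * q)))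
          \<le> (SUP f\<in>hoelder_ball \<beta> R. ennreal ((bias (P f) T (f x\<^sub>0))\<^sup>2))"
        by (auto intro: SUP_upper2 ennreal_leI)
    next
      fix f assume nb: "n \<ge> b" and f: "f \<in> hoelder_ball \<beta> ((R - kappa \<beta>) / 2)"
      \<comment> \<open>Variance: \<open>b\<close> may exceed 1, so the bound
        \<open>h \<le> 1\<close> comes from the threshold \<open>n \<ge> b\<close>.\<close>
      define h where "h = (b / n) powr (1 / (\<beta> + 1))"
      define g where "g = (\<lambda>x. f x + bump \<beta> h x\<^sub>0 x)"
      have r: "0 \<le> (R - kappa \<beta>) / 2" "(R - kappa \<beta>) / 2 + 2 \<le> R"
        using \<kappa> assms by (auto simp: field_simps)
      have fR: "f \<in> hoelder_ball \<beta> R"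
        using f \<kappa> assms unfolding hoelder_ball_def
        by (auto elim!: order_trans intro!: ennreal_leI)
      have g: "g \<in> hoelder_ball \<beta> R" "g x\<^sub>0 = f x\<^sub>0 + (b / n) powr q"
        "(prob_space.expectation (P g) T - prob_space.expectation (P f) T)\<^sup>2
          \<le> (exp (2 * b) - 1) * prob_space.variance (P f) T"
        using two_point[OF f fR r b(1) nb h_def] by (auto simp: g_def)
      have "(b / n) powr q = 3 * u"
        using b assms n by (simp add: u_def powr_divide)
      \<comment> \<open>The targets are \<open>3 * u\<close> apart and each bias is at most
        \<open>u\<close> in absolute value, so a gap of at least \<open>u\<close> remains between
        the expectations.\<close>
      then have "u \<le> prob_space.expectation (P g) T - prob_space.expectation (P f) T"
        using risk(3)[OF fR] risk(3)[OF g(1)] g(2) unfolding bias_def by linarith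
      then have "u\<^sup>2 \<le> (prob_space.expectation (P g) T - prob_space.expectation (P f) T)\<^sup>2"
        using u by (intro power_mono) auto
      also note g(3)
      finally have "u\<^sup>2 / (exp (2 * b) - 1) \<le> prob_space.variance (P f) T"
        using b by (simp add: divide_le_eq mult.commute)
      moreover have "u\<^sup>2 = C powr (2 * q) * n powr (- (2 * q))"
        using assms n by (simp add: u_def scale flip: square)
      ultimately show "c' * n powr (- (2 * q)) \<le> prob_space.variance (P f) T"
        by (simp add: c'_def)
    qed
  qed
  have c: "c > 0" "c' > 0" using a b assms by (auto simp: c_def c'_def)
  show ?thesis
    unfolding q2
    by (rule exI[of _ c], rule conjI[OF c(1)], rule exI[of _ c'], rule conjI[OF c(2)],
        rule exI[of _ b], intro allI impI ballI, rule main)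
qed

end
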